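(* Let $n\ge 1$, let $r\in\mathcal{D}_n$, and let $M\subset \mathcal{P}_{2n}/\Pi_r$. Assume that there are positive constants $C_0$, $C_1$ and $C_2$ such that $m_r([Y])\geq C_0$, $\det([Y])\leq C_1$ and $d_n([Y])\leq C_2$ for all $[Y]\in M$. Then $M$ has compact closure in $\mathcal{P}_{2n}/\Pi_r$.
   Context: $\mathcal{P}_{k}$ denotes the space of real symmetric positive definite $k\times k$ matrices. $\mathrm{GL}(k;\mathbb{R})$ acts on $\mathcal{P}_k$ from the right by $Y[G]:={}^{t}G\,Y\,G$; also write $Y[a]:={}^{t}a\,Y\,a$ for $a\in\mathbb{R}^k$. $J=\begin{pmatrix}0&\mathrm{Id}_n\\-\mathrm{Id}_n&0\end{pmatrix}$ and $\widetilde{\mathrm{Sp}}(2n;\mathbb{R}):=\{\beta\in\mathrm{GL}(2n;\mathbb{R}) : {}^{t}\beta J\beta=\epsilon(\beta)J,\ \epsilon(\beta)\in\{1,-1\}\}$. $\mathcal{D}_n$ is the set of $n$-tuples $r=(r_1,\dots,r_n)$ of positive integers with $r_i\mid r_{i+1}$ for $1\le i\le n-1$. For $r\in\mathcal{D}_n$ put $\delta_r:=\mathrm{diag}(r_1,\dots,r_n,1,\dots,1)$ (a $2n\times 2n$ matrix), $G_r:=\delta_r\,\mathrm{GL}(2n;\mathbb{Z})\,\delta_r^{-1}$ and $\Pi_r:=G_r\cap\widetilde{\mathrm{Sp}}(2n;\mathbb{R})$. The quotient $\mathcal{P}_{2n}/\Pi_r$ is the orbit space of the right action $(Y,G)\mapsto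 Y[G]={}^{t}G\,Y\,G$ of $\Pi_r\subset\mathrm{GL}(2n;\mathbb{R})$ on $\mathcal{P}_{2n}$, with the quotient topology; $[Y]$ is the class of $Y$. For $Y\in\mathcal{P}_{2n}$: $m_r(Y):=\inf\{Y[\delta_r a] : a\in\mathbb{Z}^{2n}\setminus\{0\}\}$. The matrix $Y^{-1}J$ has purely imaginary nonzero eigenvalues in complex conjugate pairs; $0<d_1(Y)\le\dots\le d_n(Y)$ are defined so that $\pm i\,d_k(Y)$, $k=1,\dots,n$, are the eigenvalues of $Y^{-1}J$ (with multiplicity). The functions $m_r$, $\det$ and $d_n$ on $\mathcal{P}_{2n}$ are invariant under $\Pi_r$ and so induce functions on $\mathcal{P}_{2n}/\Pi_r$, denoted by the same symbols. *)

theory Defs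
  imports "HOL-Analysis.Analysis" "HOL-Computational_Algebra.Computational_Algebra"
begin

text \<open>
  The number \<open>n \<ge> 1\<close> is \<open>CARD('n)\<close> for an arbitrary index type \<open>'n\<close> that is finite and linearly
  ordered; the order plays the role of the order of \<open>1, \<dots>, n\<close>. The \<open>2n\<close> coordinates are indexed
  by \<open>'n + 'n\<close>, where \<open>Inl\<close> gives the first block of \<open>n\<close> coordinates and \<open>Inr\<close> the second.
\<close>

definition posdef_mats :: "(real^'m^'m) set" where
  "posdef_mats = {Y. transpose Y = Y \<and> (\<forall>x. x \<noteq> 0 \<longrightarrow> 0 < x \<bullet> (Y *v x))}"

definition mat_act :: "real^'m^'m \<Rightarrow> real^'m^'m \<Rightarrow> real^'m^'m" where
  "mat_act Y G = transpose G ** Y ** G"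

definition quad_form :: "real^'m^'m \<Rightarrow> real^'m \<Rightarrow> real" where
  "quad_form Y a = a \<bullet> (Y *v a)"

definition symp_J :: "real^('n::finite + 'n)^('n + 'n)" where
  "symp_J = (\<chi> i j. case (i, j) of
       (Inl k, Inr l) \<Rightarrow> if k = l then 1 else 0
     | (Inr k, Inl l) \<Rightarrow> if k = l then - 1 else 0
     | _ \<Rightarrow> 0)"

definition ext_Sp :: "(real^('n::finite + 'n)^('n + 'n)) set" where
  "ext_Sp = {\<beta>. invertible \<beta> \<and>
     (\<exists>\<epsilon>\<in>{1, - 1}. transpose \<beta> ** symp_J ** \<beta> = \<epsilon> *\<^sub>R symp_J)}"

text \<open>The side condition on \<open>i\<close> and \<open>j\<close> says that \<open>j\<close> is the immediate successor of \<open>i\<close>.\<close>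

definition div_chains :: "(nat^'n::{finite,linorder}) set" where
  "div_chains = {r. (\<forall>i. 0 < r $ i) \<and>
     (\<forall>i j. i < j \<and> {i<..<j} = {} \<longrightarrow> r $ i dvd r $ j)}"

definition delta :: "nat^'n::finite \<Rightarrow> real^('n + 'n)^('n + 'n)" where
  "delta r = (\<chi> i j. if i = j then (case i of Inl k \<Rightarrow> real (r $ k) | Inr _ \<Rightarrow> 1) else 0)"

definition real_vec_of_int :: "int^'m \<Rightarrow> real^'m" where
  "real_vec_of_int a = (\<chi> i. real_of_int (a $ i))"

definition real_mat_of_int :: "int^'m^'m \<Rightarrow> real^'m^'m" where
  "real_mat_of_int U = (\<chi> i j. real_of_int (U $ i $ j))"

text \<open>
  For \<open>U :: int^'m^'m\<close>, \<^term>\<open>invertible U\<close> asks for a two-sided inverse with integer entries, so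
  these \<open>U\<close> form \<open>GL(2n; \<int>)\<close>.
\<close>

definition G_grp :: "nat^'n::finite \<Rightarrow> (real^('n + 'n)^('n + 'n)) set" where
  "G_grp r = {delta r ** real_mat_of_int U ** matrix_inv (delta r) | U. invertible U}"

definition Pi_grp :: "nat^'n::finite \<Rightarrow> (real^('n + 'n)^('n + 'n)) set" where
  "Pi_grp r = G_grp r \<inter> ext_Sp"

definition orbit :: "nat^'n::finite \<Rightarrow> real^('n + 'n)^('n + 'n) \<Rightarrow> (real^('n + 'n)^('n + 'n)) set" where
  "orbit r Y = mat_act Y ` Pi_grp r"

definition quotient_topology :: "'a topology \<Rightarrow> ('a \<Rightarrow> 'b) \<Rightarrow> 'b topology" where
  "quotient_topology X q =
     topology (\<lambda>U. U \<subseteq> q ` topspace X \<and> openin X {x \<in> topspace X. q x \<in> U})"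

lemma openin_quotient_topology:
  "openin (quotient_topology X q) U \<longleftrightarrow>
     U \<subseteq> q ` topspace X \<and> openin X {x \<in> topspace X. q x \<in> U}"
proof -
  have "istopology (\<lambda>U. U \<subseteq> q ` topspace X \<and> openin X {x \<in> topspace X. q x \<in> U})"
    unfolding istopology_def
  proof (intro conjI allI impI)
    fix S T
    assume "S \<subseteq> q ` topspace X \<and> openin X {x \<in> topspace X. q x \<in> S}"
      and "T \<subseteq> q ` topspace X \<and> openin X {x \<in> topspace X. q x \<in> T}"
    moreover have "{x \<in> topspace X. q x \<in> S \<inter> T} =
        {x \<in> topspace X. q x \<in> S} \<inter> {x \<in> topspace X. q x \<in> T}" by auto
    ultimately show "S \<inter> T \<subseteq> q ` topspace X" "openin X {x \<in> topspace X. q x \<in> S \<inter> T}"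
      by auto
  next
    fix K
    assume K: "\<forall>S\<in>K. S \<subseteq> q ` topspace X \<and> openin X {x \<in> topspace X. q x \<in> S}"
    then show "\<Union>K \<subseteq> q ` topspace X" by auto
    have "{x \<in> topspace X. q x \<in> \<Union>K} = (\<Union>S\<in>K. {x \<in> topspace X. q x \<in> S})" by auto
    with K show "openin X {x \<in> topspace X. q x \<in> \<Union>K}" by auto
  qed
  then show ?thesis
    by (simp add: quotient_topology_def topology_inverse')
qed

lemma topspace_quotient_topology: "topspace (quotient_topology X q) = q ` topspace X"
proof (rule antisym)
  show "topspace (quotient_topology X q) \<subseteq> q ` topspace X"
    using openin_quotient_topology[of X q] openin_topspace by blast
  have "{x \<in> topspace X. q x \<in> q ` topspace X} = topspace X" by auto
  then have "openin (quotient_topology X q) (q ` topspace X)"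
    by (simp add: openin_quotient_topology)
  then show "q ` topspace X \<subseteq> topspace (quotient_topology X q)"
    by (rule openin_subset)
qed

lemma quotient_map_quotient_topology: "quotient_map X (quotient_topology X q) q"
  by (auto simp: quotient_map_def topspace_quotient_topology openin_quotient_topology)

definition orbit_space :: "nat^'n::finite \<Rightarrow> (real^('n + 'n)^('n + 'n)) set topology" where
  "orbit_space r = quotient_topology (top_of_set posdef_mats) (orbit r)"

definition m_min :: "nat^'n::finite \<Rightarrow> real^('n + 'n)^('n + 'n) \<Rightarrow> real" where
  "m_min r Y = Inf {quad_form Y (delta r *v real_vec_of_int a) | a. a \<noteq> 0}"

definition charpoly :: "complex^'m^'m \<Rightarrow> complex poly" where
  "charpoly A = det (mat [:0, 1:] - (\<chi> i j. [:A $ i $ j:]))"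

text \<open>
  The eigenvalues of \<open>Y\<^sup>-\<^sup>1 J\<close>, with multiplicity, are \<open>\<plusminus> \<i> d\<^sub>1, \<dots>, \<plusminus> \<i> d\<^sub>n\<close> with \<open>d\<^sub>k > 0\<close>; so the \<open>d\<^sub>k\<close>
  are the positive imaginary parts of these eigenvalues. Lists are indexed from \<open>0\<close>.
\<close>

definition symp_eigenvalues :: "real^('n::finite + 'n)^('n + 'n) \<Rightarrow> real list" where
  "symp_eigenvalues Y =
     sorted_list_of_multiset (filter_mset (\<lambda>t. 0 < t) (image_mset Im
       (proots (charpoly (\<chi> i j. complex_of_real ((matrix_inv Y ** symp_J) $ i $ j))))))"

definition d_eig :: "nat \<Rightarrow> real^('n::finite + 'n)^('n + 'n) \<Rightarrow> real" where
  "d_eig k Y = symp_eigenvalues Y ! (k - 1)"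

end

theory Submission
  imports Defs
begin

text \<open>
  The set \<open>M\<close> is contained in the image of a compact set \<open>K\<close> of positive definite matrices, and the
  image of a compact set is closed in the orbit space. So the closure of \<open>M\<close> is a closed subset of
  a compact set. The two halves are \<open>posdef_reduction\<close> and \<open>closedin_orbit_image\<close>.

  Reduction. Let \<open>Y\<close> satisfy the three bounds and put \<open>Y' = Y[\<delta>\<^sub>r]\<close>. The lower bound on the
  values of \<open>Y'\<close> at nonzero integer vectors says that \<open>Y'\<close>-balls of a fixed radius around the
  integer points are disjoint. Comparing volumes with the upper bound on \<open>det Y'\<close> gives two things:
  \<open>det Y'\<close> is bounded below, and the integer vectors of bounded \<open>Y'\<close>-length span the whole space.
  The latter holds because otherwise many more disjoint balls could be stacked in a direction orthogonal to
  their span. This is a substitute for reduction theory: it produces an integer matrix \<open>V\<close> with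
  nonzero determinant, but in general not unimodular, such that \<open>Z = Y'[V]\<close> lies in a fixed compact set of
  positive definite matrices (\<open>short_vectors_span\<close>, \<open>integer_frame\<close>, \<open>compact_bounded_forms\<close>).
  Then \<open>det V\<close> is bounded as well.

  The bound on \<open>d\<^sub>n\<close> controls the symplectic form. The largest \<open>d\<close> for which \<open>\<i> d\<close> is an eigenvalue of
  \<open>Y\<^sup>-\<^sup>1 J\<close> is the norm of the form \<open>J\<close> with respect to the inner product \<open>Y\<close>, so the integer matrix
  \<open>J[\<delta>\<^sub>r V]\<close> has bounded entries (\<open>symp_form_bound\<close>). Hence it takes finitely many values. The lattice
  \<open>V\<^sup>-\<^sup>1 \<int>\<^sup>2\<^sup>n\<close> takes finitely many values too, since it lies between \<open>\<int>\<^sup>2\<^sup>n\<close> and \<open>(det V)\<^sup>-\<^sup>1 \<int>\<^sup>2\<^sup>n\<close>.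
  If \<open>V\<close> and \<open>W\<close> agree in both data, then \<open>U = V W\<^sup>-\<^sup>1\<close> is unimodular by the second
  (\<open>lattice_key_unimodular\<close>) and \<open>G = \<delta>\<^sub>r U \<delta>\<^sub>r\<^sup>-\<^sup>1\<close> preserves \<open>J\<close> by the first, so \<open>G \<in> \<Pi>\<^sub>r\<close>.
  Choosing one representative \<open>W\<close> for each of the finitely many data, \<open>Y[G] = Z[(\<delta>\<^sub>r W)\<^sup>-\<^sup>1]\<close> lies in
  a finite union of compact sets.

  Closedness. If \<open>Y = Z[G]\<close> with \<open>Z \<in> K\<close> and \<open>Y\<close> bounded, then \<open>G\<close> is bounded, and \<open>\<Pi>\<^sub>r\<close> is discrete.
  So the saturation of \<open>K\<close> is locally a finite union of compact sets.
\<close>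

section \<open>Volumes of linear images\<close>

text \<open>
  The matrix of a shear arises from the identity matrix by adding one row to another.
\<close>

lemma det_shear:
  fixes m n :: "'m::finite"
  assumes "m \<noteq> n"
  shows "det (matrix (\<lambda>x::real^'m. \<chi> i. if i = m then x $ m + x $ n else x $ i)) = 1"
proof -
  have "matrix (\<lambda>x::real^'m. \<chi> i. if i = m then x $ m + x $ n else x $ i) =
      (\<chi> k. if k = m then row m (mat 1) + 1 *s row n (mat 1) else row k (mat 1))"
    by (auto simp: matrix_def row_def axis_def mat_def vec_eq_iff)
  then show ?thesis
    using det_row_operation[of m n "mat 1 :: real^'m^'m" 1] assms by simp
qed

lemma det_coordinate_swap:
  fixes m n :: "'m::finite"
  shows "\<bar>det (matrix (\<lambda>x::real^'m. \<chi> i. x $ Transposition.transpose m n i))\<bar> = 1"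
proof -
  let ?h = "\<lambda>x::real^'m. \<chi> i. x $ Transposition.transpose m n i"
  have lin: "linear ?h" by (rule linearI) (simp_all add: vec_eq_iff)
  have "?h \<circ> ?h = id" by (auto simp: vec_eq_iff)
  then have "matrix ?h ** matrix ?h = mat 1"
    using matrix_compose[OF lin lin] by (metis matrix_id_mat_1)
  then have "det (matrix ?h) * det (matrix ?h) = 1" by (metis det_I det_mul)
  then show ?thesis by (simp add: abs_square_eq_1 flip: power2_eq_square)
qed

text \<open>
  Both sides of the scaling law are multiplicative in \<open>f\<close>, so it suffices to treat the elementary maps:
  maps into a coordinate hyperplane, diagonal maps, coordinate swaps and shears.
\<close>

proposition volume_linear_image:
  fixes f :: "real^'m::finite \<Rightarrow> real^'m"
  assumes "linear f" "S \<in> lmeasurable"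
  shows "f ` S \<in> lmeasurable \<and>
    measure lebesgue (f ` S) = \<bar>det (matrix f)\<bar> * measure lebesgue S"
proof -
  have "\<forall>S\<in>lmeasurable. f ` S \<in> lmeasurable \<and>
    measure lebesgue (f ` S) = \<bar>det (matrix f)\<bar> * measure lebesgue S"
  proof (rule induct_linear_elementary[OF assms(1)], goal_cases)
    case (1 f g)
    have im: "(f \<circ> g) ` S = f ` (g ` S)" for S by auto
    have mat: "\<bar>det (matrix (f \<circ> g))\<bar> = \<bar>det (matrix f)\<bar> * \<bar>det (matrix g)\<bar>"
      by (simp only: matrix_compose[OF 1(2) 1(1)] det_mul abs_mult)
    show ?case
      unfolding im mat using 1(3,4) by auto
  next
    case (2 f i)
    then have "\<not> inj f"
      by (metis linear_injective_imp_surjective one_neq_zero surjE vec_component)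
    with 2 have neg: "negligible (f ` S)" for S
      using negligible_linear_singular_image by blast
    have "det (matrix f) = 0"
      using 2 \<open>\<not> inj f\<close> det_nz_iff_inj by blast
    with neg show ?case
      by (simp add: negligible_iff_measure)
  next
    case (3 c)
    then show ?case
      by (simp add: measurable_stretch measure_stretch axis_def matrix_def det_diagonal)
  next
    case (4 m n)
    let ?h = "\<lambda>x::real^'m. \<chi> i. x $ Transposition.transpose m n i"
    have lin: "linear ?h" by (rule linearI) (simp_all add: vec_eq_iff)
    have "measure lebesgue (?h ` cbox a b) = measure lebesgue (cbox a b)" for a b
    proof -
      have inv: "?h (?h x) = x" for x by (simp add: vec_eq_iff)
      have "x \<in> ?h ` cbox a b \<longleftrightarrow> ?h x \<in> cbox a b" for x
      proof
        assume "x \<in> ?h ` cbox a b"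
        then obtain y where "y \<in> cbox a b" "x = ?h y" by blast
        then show "?h x \<in> cbox a b" using inv[of y] by simp
      next
        assume "?h x \<in> cbox a b"
        then show "x \<in> ?h ` cbox a b" using inv[of x] by (metis image_eqI)
      qed
      moreover have "?h x \<in> cbox a b \<longleftrightarrow> x \<in> cbox (?h a) (?h b)" for x
        by (simp add: mem_box_cart) (metis transpose_involutory)
      ultimately have eq: "?h ` cbox a b = cbox (?h a) (?h b)" by blast
      have "(\<Prod>i\<in>UNIV. ?h b $ i - ?h a $ i) = (\<Prod>i\<in>UNIV. b $ i - a $ i)"
        using prod.permute[OF permutes_swap_id[of m UNIV n], of "\<lambda>i. b $ i - a $ i"] by (simp add: o_def)
      moreover have "cbox (?h a) (?h b) = {} \<longleftrightarrow> cbox a b = {}" using eq by (metis image_is_empty)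
      ultimately show ?thesis
        using eq by (cases "cbox a b = {}") (simp_all add: content_cbox_cart)
    qed
    then have box: "measure lebesgue (?h ` cbox a b) = 1 * measure lebesgue (cbox a b)" for a b
      by (simp only: mult_1)
    show ?case
    proof (intro ballI)
      fix S :: "(real^'m) set" assume "S \<in> lmeasurable"
      note suff = measure_linear_sufficient[OF lin this box]
      show "?h ` S \<in> lmeasurable \<and> measure lebesgue (?h ` S) = \<bar>det (matrix ?h)\<bar> * measure lebesgue S"
        unfolding det_coordinate_swap
        by (intro conjI conjunct1[OF suff] conjunct2[OF suff, symmetric])
    qed
  next
    case (5 m n)
    let ?h = "\<lambda>x::real^'m. \<chi> i. if i = m then x $ m + x $ n else x $ i"
    have lin: "linear ?h"
      by (rule linearI) (auto simp: vec_eq_iff algebra_simps)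
    have "measure lebesgue (?h ` cbox a b) = measure lebesgue (cbox a b)" for a b
    proof (cases "cbox a b = {}")
      case False
      \<comment> \<open>A translation moves the box to where the \<open>n\<close>-th coordinate is nonnegative.\<close>
      let ?t = "axis n (- a $ n) :: real^'m"
      have box: "(+) ?t ` cbox a b = cbox (?t + a) (?t + b)" by (simp add: cbox_translation)
      have "?h ` (+) ?t ` cbox a b = (+) (?h ?t) ` ?h ` cbox a b"
        by (simp only: image_image linear_add[OF lin])
      then have "measure lebesgue ((+) (?h ?t) ` ?h ` cbox a b) = measure lebesgue (?h ` cbox (?t + a) (?t + b))"
        by (simp only: box)
      then have "measure lebesgue (?h ` cbox a b) = measure lebesgue (?h ` cbox (?t + a) (?t + b))"
        by (simp only: measure_translation)
      also have "\<dots> = measure lebesgue (cbox (?t + a) (?t + b))"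
        using False box 5 by (intro measure_shear_interval) (auto simp: axis_def)
      also have "\<dots> = measure lebesgue (cbox a b)"
        by (simp only: box[symmetric] measure_translation)
      finally show ?thesis .
    qed simp
    then have box: "measure lebesgue (?h ` cbox a b) = 1 * measure lebesgue (cbox a b)" for a b
      by (simp only: mult_1)
    show ?case
    proof (intro ballI)
      fix S :: "(real^'m) set" assume "S \<in> lmeasurable"
      note suff = measure_linear_sufficient[OF lin this box]
      show "?h ` S \<in> lmeasurable \<and> measure lebesgue (?h ` S) = \<bar>det (matrix ?h)\<bar> * measure lebesgue S"
        unfolding det_shear[OF 5] abs_one
        by (intro conjI conjunct1[OF suff] conjunct2[OF suff, symmetric])
    qed
  qed
  with assms(2) show ?thesis by blast
qed

section \<open>Positive definite forms and lattice packings\<close>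

lemma inner_matrix_vector: "(x::real^'m) \<bullet> (A *v y) = (transpose A *v x) \<bullet> y"
  by (simp add: dot_lmul_matrix)

lemma matrix_entry_inner: "(A::real^'m^'k) $ i $ j = axis i 1 \<bullet> (A *v axis j 1)"
  by (simp add: inner_axis' matrix_vector_mult_basis column_def)

lemma symmetric_form_commute:
  fixes Y :: "real^'m^'m"
  assumes "transpose Y = Y"
  shows "x \<bullet> (Y *v y) = y \<bullet> (Y *v x)"
  using inner_matrix_vector[of x Y y] assms by (simp only: inner_commute)

lemma quad_form_mat_act:
  fixes Y :: "real^'m^'m"
  shows "quad_form (mat_act Y G) x = quad_form Y (G *v x)"
  unfolding quad_form_def mat_act_def
  by (simp add: matrix_vector_mul_assoc[symmetric] inner_matrix_vector[of x] del: transpose_matrix_vector)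

lemma quad_form_add:
  fixes Y :: "real^'m^'m"
  assumes "transpose Y = Y"
  shows "quad_form Y (x + y) = quad_form Y x + 2 * (x \<bullet> (Y *v y)) + quad_form Y y"
  using symmetric_form_commute[OF assms, of x y]
  by (simp add: quad_form_def matrix_vector_right_distrib inner_simps)

lemma quad_form_scaleR: "quad_form Y (c *\<^sub>R x) = c\<^sup>2 * quad_form Y x"
  by (simp add: quad_form_def matrix_vector_mult_scaleR power2_eq_square)

lemma posdefD:
  fixes Y :: "real^'m^'m"
  assumes "Y \<in> posdef_mats"
  shows "transpose Y = Y" and "x \<noteq> 0 \<Longrightarrow> 0 < quad_form Y x" and "0 \<le> quad_form Y x"
  using assms by (cases "x = 0"; force simp: posdef_mats_def quad_form_def)+

lemma mat_act_posdef:
  assumes "Y \<in> posdef_mats" "invertible G"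
  shows "mat_act Y G \<in> posdef_mats"
proof -
  have "transpose (mat_act Y G) = mat_act Y G"
    using posdefD(1)[OF assms(1)] by (simp add: mat_act_def matrix_transpose_mul matrix_mul_assoc)
  moreover have "0 < quad_form (mat_act Y G) x" if "x \<noteq> 0" for x
  proof -
    have "G *v x \<noteq> 0"
      using assms(2) that by (metis invertible_left_inverse matrix_left_invertible_ker)
    then show ?thesis
      using posdefD(2)[OF assms(1)] by (simp add: quad_form_mat_act)
  qed
  ultimately show ?thesis by (simp add: posdef_mats_def quad_form_def)
qed

text \<open>
  Gram-Schmidt for the inner product \<open>Y\<close>: a vector that is Euclidean-orthogonal to the fewer than
  \<open>CARD('m)\<close> vectors \<open>Y f\<^sub>i\<close> is \<open>Y\<close>-orthogonal to the \<open>f\<^sub>i\<close>.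
\<close>

lemma orthonormal_frame:
  fixes Y :: "real^'m^'m"
  assumes Y: "Y \<in> posdef_mats"
  obtains P :: "real^'m^'m" where "transpose P ** Y ** P = mat 1"
proof -
  have "\<exists>f. \<forall>i\<in>I. \<forall>j\<in>I. f i \<bullet> (Y *v f j) = (if i = j then 1 else 0)" for I :: "'m set"
    using finite[of I]
  proof (induction I rule: finite_induct)
    case (insert k I)
    then obtain f where f: "\<And>i j. i \<in> I \<Longrightarrow> j \<in> I \<Longrightarrow> f i \<bullet> (Y *v f j) = (if i = j then 1 else 0)"
      by blast
    have "dim ((\<lambda>i. Y *v f i) ` I) \<le> card ((\<lambda>i. Y *v f i) ` I)"
      by (simp add: dim_le_card')
    also have "\<dots> \<le> card I" by (rule card_image_le) simp
    also have "card I < CARD('m)"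
      using insert.hyps by (metis finite insert_absorb top.not_eq_extremum psubset_card_mono UNIV_I)
    finally obtain v where v: "v \<noteq> 0" "\<And>y. y \<in> span ((\<lambda>i. Y *v f i) ` I) \<Longrightarrow> orthogonal v y"
      using orthogonal_to_subspace_exists[of "(\<lambda>i. Y *v f i) ` I"] by auto
    define u where "u = (1 / sqrt (quad_form Y v)) *\<^sub>R v"
    have "0 < quad_form Y v" using posdefD(2)[OF Y v(1)] .
    then have uu: "u \<bullet> (Y *v u) = 1"
      unfolding quad_form_def[symmetric] u_def quad_form_scaleR by (simp add: power_divide)
    have uI: "u \<bullet> (Y *v f i) = 0" if "i \<in> I" for i
      using v(2)[of "Y *v f i"] that by (auto simp: u_def orthogonal_def span_base)
    moreover have "f i \<bullet> (Y *v u) = 0" if "i \<in> I" for i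
      using uI[OF that] symmetric_form_commute[OF posdefD(1)[OF Y]] by metis
    ultimately have "\<forall>i\<in>insert k I. \<forall>j\<in>insert k I.
        (f(k := u)) i \<bullet> (Y *v (f(k := u)) j) = (if i = j then 1 else 0)"
      using f uu insert.hyps by auto
    then show ?case by blast
  qed simp
  from this[of UNIV] obtain f :: "'m \<Rightarrow> real^'m"
    where f: "\<And>i j. f i \<bullet> (Y *v f j) = (if i = j then 1 else 0)" by auto
  define P :: "real^'m^'m" where "P = (\<chi> i j. f j $ i)"
  have P: "P *v axis j 1 = f j" for j
    by (simp add: P_def matrix_vector_mult_basis column_def)
  have "(transpose P ** Y ** P) $ i $ j = (mat 1 :: real^'m^'m) $ i $ j" for i j
    unfolding matrix_entry_inner[of "transpose P ** Y ** P"]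
    using f[of i j]
    by (simp add: matrix_vector_mul_assoc[symmetric] P inner_matrix_vector[of "axis i 1"] mat_def
        del: transpose_matrix_vector)
  then have "transpose P ** Y ** P = mat 1" by (simp add: vec_eq_iff)
  then show ?thesis by (rule that)
qed

lemma frame_invertible:
  fixes P :: "real^'m^'m"
  assumes "transpose P ** Y ** P = (mat 1 :: real^'m^'m)"
  shows "invertible P"
  using assms invertible_left_inverse by blast

lemma frame_quad_form:
  fixes P :: "real^'m^'m"
  assumes "transpose P ** Y ** P = (mat 1 :: real^'m^'m)"
  shows "quad_form Y (P *v x) = x \<bullet> x"
  using assms quad_form_mat_act[of Y P x] by (simp add: mat_act_def quad_form_def)

lemma frame_det:
  fixes P :: "real^'m^'m"
  assumes "transpose P ** Y ** P = (mat 1 :: real^'m^'m)"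
  shows "(det P)\<^sup>2 * det Y = 1"
proof -
  have "det (transpose P ** Y ** P) = 1" using assms by simp
  then show ?thesis by (simp add: det_mul power2_eq_square mult_ac)
qed

lemma posdef_det_pos: "Y \<in> posdef_mats \<Longrightarrow> 0 < det (Y :: real^'m^'m)"
  by (metis frame_det orthonormal_frame zero_less_mult_pos zero_less_one zero_less_power2 mult_zero_left zero_eq_power2)

lemma finite_vecs_componentwise:
  assumes "\<And>i. finite (F i)"
  shows "finite {a :: 'a^'m. \<forall>i. a $ i \<in> F i}"
proof (rule finite_surj)
  show "finite (PiE UNIV F)" using assms by (intro finite_PiE) auto
  show "{a :: 'a^'m. \<forall>i. a $ i \<in> F i} \<subseteq> vec_lambda ` PiE UNIV F"
  proof
    fix a :: "'a^'m" assume "a \<in> {a. \<forall>i. a $ i \<in> F i}"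
    then have "(\<lambda>i. a $ i) \<in> PiE UNIV F" "a = vec_lambda (\<lambda>i. a $ i)" by auto
    then show "a \<in> vec_lambda ` PiE UNIV F" by blast
  qed
qed

text \<open>
  Blichfeldt's principle. Cut \<open>S\<close> along the unit cubes of the integer grid and move all pieces to the
  cube at the origin: they remain disjoint there, and the cube has volume \<open>1\<close>.
\<close>

lemma measure_le_1_if_translates_disjoint:
  fixes S :: "(real^'m) set"
  assumes S: "S \<in> lmeasurable" "bounded S"
    and disj: "\<And>x y a. x \<in> S \<Longrightarrow> y \<in> S \<Longrightarrow> x = y + real_vec_of_int a \<Longrightarrow> a = 0"
  shows "measure lebesgue S \<le> 1"
proof -
  define fl :: "real^'m \<Rightarrow> int^'m" where "fl x = (\<chi> i. \<lfloor>x $ i\<rfloor>)" for x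
  define A where "A = fl ` S"
  define C where "C a = {x \<in> S. fl x = a}" for a
  define D where "D a = (+) (- real_vec_of_int a) ` C a" for a
  have finA: "finite A"
  proof -
    obtain R where R: "\<And>x. x \<in> S \<Longrightarrow> norm x \<le> R" using S(2) bounded_iff by blast
    have "A \<subseteq> {a. \<forall>i. a $ i \<in> {- \<lceil>R\<rceil> - 1 .. \<lceil>R\<rceil>}}"
    proof -
      have "\<lfloor>x $ i\<rfloor> \<in> {- \<lceil>R\<rceil> - 1 .. \<lceil>R\<rceil>}" if "x \<in> S" for x :: "real^'m" and i
        using component_le_norm_cart[of x i] R[OF that] by (auto simp: abs_le_iff) linarith+
      then show ?thesis by (auto simp: A_def fl_def)
    qed
    then show ?thesis by (rule finite_subset) (intro finite_vecs_componentwise, simp)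
  qed
  have meas: "C a \<in> lmeasurable" for a
  proof -
    have eq: "C a = S \<inter> ((\<Inter>i. {x. real_of_int (a $ i) \<le> x $ i}) \<inter> (\<Inter>i. {x. x $ i < real_of_int (a $ i) + 1}))"
      by (auto simp: C_def fl_def vec_eq_iff floor_eq_iff)
    have "closed (\<Inter>i. {x::real^'m. real_of_int (a $ i) \<le> x $ i})"
      using closed_halfspace_component_ge_cart by (intro closed_INT) blast
    moreover have "open (\<Inter>i. {x::real^'m. x $ i < real_of_int (a $ i) + 1})"
      using open_halfspace_component_lt_cart by (intro open_INT) auto
    ultimately have "(\<Inter>i. {x::real^'m. real_of_int (a $ i) \<le> x $ i}) \<inter>
        (\<Inter>i. {x. x $ i < real_of_int (a $ i) + 1}) \<in> sets lebesgue"
      by (intro sets.Int) auto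
    with S(1) show ?thesis unfolding eq by (rule fmeasurable_Int_fmeasurable)
  qed
  then have measD: "D a \<in> lmeasurable" for a
    unfolding D_def using measurable_translation by blast
  have "D a \<inter> D b = {}" if "a \<noteq> b" for a b
  proof (rule ccontr)
    assume "D a \<inter> D b \<noteq> {}"
    then obtain x y where xy: "x \<in> C a" "y \<in> C b" "- real_vec_of_int a + x = - real_vec_of_int b + y"
      unfolding D_def by auto
    then have "x = y + real_vec_of_int (a - b)"
      by (simp add: vec_eq_iff real_vec_of_int_def algebra_simps)
    moreover have "x \<in> S" "y \<in> S" using xy by (auto simp: C_def)
    ultimately have "a - b = 0" by (rule disj[rotated 2])
    with that show False by simp
  qed
  then have disjD: "pairwise (\<lambda>a b. disjnt (D a) (D b)) A"
    by (simp add: pairwise_def disjnt_def)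
  have "S = (\<Union>a\<in>A. C a)" by (auto simp: A_def C_def)
  then have "measure lebesgue S = measure lebesgue (\<Union>a\<in>A. C a)" by simp
  also have "\<dots> = (\<Sum>a\<in>A. measure lebesgue (C a))"
    by (rule measure_UNION') (use finA meas in \<open>auto simp: pairwise_def disjnt_def C_def\<close>)
  also have "\<dots> = (\<Sum>a\<in>A. measure lebesgue (D a))"
    by (simp only: D_def measure_translation)
  also have "\<dots> = measure lebesgue (\<Union>a\<in>A. D a)"
    by (rule measure_UNION'[symmetric]) (use finA measD disjD in auto)
  also have "\<dots> \<le> measure lebesgue (cbox 0 1 :: (real^'m) set)"
  proof (rule measure_mono_fmeasurable)
    show "(\<Union>a\<in>A. D a) \<subseteq> cbox 0 1"
    proof -
      have "0 \<le> x $ i - of_int \<lfloor>x $ i\<rfloor> \<and> x $ i - of_int \<lfloor>x $ i\<rfloor> \<le> 1" for x :: "real^'m" and i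
        by linarith
      then show ?thesis
        by (auto simp: D_def C_def fl_def real_vec_of_int_def mem_box_cart)
    qed
  qed (use finA measD in auto)
  also have "\<dots> = 1"
    by (simp add: content_cbox_cart interval_ne_empty_cart)
  finally show ?thesis .
qed

text \<open>
  The assumption says that the open \<open>Y\<close>-balls of radius \<open>\<rho>\<close> around the points \<open>t + a\<close> are disjoint, for
  \<open>t \<in> T\<close> and \<open>a\<close> an integer vector. One such ball has volume \<open>vol(B\<^sub>\<rho>) / sqrt (det Y)\<close>, and the union of those
  around \<open>T\<close> meets no integer translate of itself, so Blichfeldt's principle applies.
\<close>

lemma lattice_packing_bound:
  fixes Y :: "real^'m^'m"
  assumes Y: "Y \<in> posdef_mats" and "finite T" and "0 < \<rho>"
    and sep: "\<And>s t a. s \<in> T \<Longrightarrow> t \<in> T \<Longrightarrow> quad_form Y (s - t + real_vec_of_int a) < 4 * \<rho>\<^sup>2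
      \<Longrightarrow> s = t \<and> a = 0"
  shows "real (card T) * measure lebesgue (ball (0::real^'m) \<rho>) \<le> sqrt (det Y)"
proof -
  obtain P :: "real^'m^'m" where P: "transpose P ** Y ** P = mat 1"
    using orthonormal_frame[OF Y] by blast
  define E where "E = (*v) P ` ball 0 \<rho>"
  have lin: "linear ((*v) P)" by simp
  have E: "E \<in> lmeasurable"
    and measE: "measure lebesgue E = \<bar>det P\<bar> * measure lebesgue (ball (0::real^'m) \<rho>)"
    using volume_linear_image[OF lin lmeasurable_ball[of 0 \<rho>]] by (simp_all add: E_def)
  have bE: "bounded E"
    unfolding E_def using lin by (intro bounded_linear_image) (auto simp: linear_linear)
  have close: "quad_form Y (e - e') < 4 * \<rho>\<^sup>2" if e: "e \<in> E" "e' \<in> E" for e e'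
  proof -
    obtain x x' where x: "e = P *v x" "e' = P *v x'" "norm x < \<rho>" "norm x' < \<rho>"
      using e by (auto simp: E_def)
    have "quad_form Y (e - e') = (norm (x - x'))\<^sup>2"
      using frame_quad_form[OF P, of "x - x'"] x
      by (simp add: matrix_vector_mult_diff_distrib dot_square_norm)
    also have "norm (x - x') < 2 * \<rho>" using x norm_triangle_ineq4[of x x'] by linarith
    then have "(norm (x - x'))\<^sup>2 < (2 * \<rho>)\<^sup>2" by (intro power_strict_mono) auto
    finally show ?thesis by (simp add: power_mult_distrib)
  qed
  define S where "S = (\<Union>t\<in>T. (+) t ` E)"
  have tr: "(+) t ` E \<in> lmeasurable" for t using E by (rule measurable_translation)
  have "disjnt ((+) s ` E) ((+) t ` E)" if st: "s \<in> T" "t \<in> T" "s \<noteq> t" for s t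
  proof (rule ccontr)
    assume "\<not> ?thesis"
    then obtain e e' where e: "e \<in> E" "e' \<in> E" "s + e = t + e'" unfolding disjnt_def by auto
    then have "s - t + real_vec_of_int 0 = e' - e"
      by (simp add: real_vec_of_int_def vec_eq_iff algebra_simps)
    then show False using sep[OF st(1,2), of 0] close[OF e(2,1)] st(3) by simp
  qed
  then have "measure lebesgue S = (\<Sum>t\<in>T. measure lebesgue ((+) t ` E))"
    unfolding S_def using assms(2) tr by (intro measure_UNION') (auto simp: pairwise_def)
  then have "measure lebesgue S = real (card T) * measure lebesgue E"
    by (simp add: measure_translation)
  moreover have "measure lebesgue S \<le> 1"
  proof (rule measure_le_1_if_translates_disjoint)
    show "S \<in> lmeasurable" unfolding S_def using assms(2) tr by (intro fmeasurable.finite_UN) auto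
    show "bounded S" unfolding S_def using assms(2) bE by (auto simp: bounded_translation)
    fix x y and a :: "int^'m"
    assume "x \<in> S" "y \<in> S" and xy: "x = y + real_vec_of_int a"
    then obtain s t e e' where e: "s \<in> T" "t \<in> T" "e \<in> E" "e' \<in> E" "y = s + e" "x = t + e'"
      unfolding S_def by auto
    then have "s - t + real_vec_of_int a = e' - e"
      using xy by (simp add: algebra_simps)
    then show "a = 0" using sep[OF e(1,2), of a] close[OF e(4,3)] by simp
  qed
  ultimately have le: "real (card T) * (\<bar>det P\<bar> * measure lebesgue (ball (0::real^'m) \<rho>)) \<le> 1"
    using measE by simp
  have "0 < det Y" using posdef_det_pos[OF Y] .
  then have "\<bar>det P\<bar> * sqrt (det Y) = 1"
    using frame_det[OF P] by (metis real_sqrt_abs real_sqrt_mult real_sqrt_one)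
  then have "real (card T) * measure lebesgue (ball (0::real^'m) \<rho>) =
      real (card T) * (\<bar>det P\<bar> * measure lebesgue (ball (0::real^'m) \<rho>)) * sqrt (det Y)"
    by (simp add: mult_ac)
  also have "\<dots> \<le> 1 * sqrt (det Y)"
    using le \<open>0 < det Y\<close> by (intro mult_right_mono) auto
  finally show ?thesis by simp
qed

section \<open>Short integer frames\<close>

text \<open>
  This is the packing bound for a single ball, whose diameter is the minimal length \<open>sqrt c\<close>.
\<close>

lemma det_lower_bound_of_minimum:
  fixes Y :: "real^'m^'m"
  assumes Y: "Y \<in> posdef_mats" and "0 < c"
    and min: "\<And>a. a \<noteq> 0 \<Longrightarrow> c \<le> quad_form Y (real_vec_of_int a)"
  shows "(measure lebesgue (ball (0::real^'m) (sqrt c / 2)))\<^sup>2 \<le> det Y"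
proof -
  have "real (card {0::real^'m}) * measure lebesgue (ball (0::real^'m) (sqrt c / 2)) \<le> sqrt (det Y)"
  proof (rule lattice_packing_bound[OF Y])
    fix s t :: "real^'m" and a :: "int^'m"
    assume "s \<in> {0}" "t \<in> {0}" "quad_form Y (s - t + real_vec_of_int a) < 4 * (sqrt c / 2)\<^sup>2"
    then show "s = t \<and> a = 0" using min[of a] \<open>0 < c\<close> by (auto simp: power_divide)
  qed (use \<open>0 < c\<close> in auto)
  then show ?thesis
    using posdef_det_pos[OF Y] by (simp add: real_le_rsqrt sqrt_ge_absD)
qed

text \<open>
  If the short integer vectors lay in a proper subspace, pick a \<open>Y\<close>-unit vector \<open>u\<close> that is \<open>Y\<close>-orthogonal to
  it and stack \<open>N\<close> balls of diameter \<open>sqrt c\<close> along \<open>u\<close>. A close encounter of two lattice translates of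
  these balls would come from a short integer vector, which is orthogonal to \<open>u\<close>; by Pythagoras both its
  length and the shift along \<open>u\<close> would be too small to be nonzero. So the packing bound is violated.
\<close>

lemma short_vectors_span:
  fixes Y :: "real^'m^'m"
  assumes Y: "Y \<in> posdef_mats" and "0 < c"
    and min: "\<And>a. a \<noteq> 0 \<Longrightarrow> c \<le> quad_form Y (real_vec_of_int a)"
    and N: "sqrt (det Y) < real N * measure lebesgue (ball (0::real^'m) (sqrt c / 2))"
  shows "span {real_vec_of_int a | a. quad_form Y (real_vec_of_int a) \<le> 2 * c * (1 + (real N)\<^sup>2)} = UNIV"
    (is "span ?X = UNIV")
proof (rule ccontr)
  assume "span ?X \<noteq> UNIV"
  then have "span ?X \<subset> span UNIV" by auto
  then obtain w where w: "w \<noteq> 0" "\<And>y. y \<in> span ?X \<Longrightarrow> orthogonal w y"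
    by (rule orthogonal_to_subspace_exists_gen) blast
  have symY: "transpose Y = Y" using posdefD(1)[OF Y] .
  obtain Yi where Yi: "Y ** Yi = mat 1"
    using posdef_det_pos[OF Y] invertible_det_nz[of Y] by (metis invertible_def less_irrefl)
  define v where "v = Yi *v w"
  have Yv: "Y *v v = w" by (simp add: v_def matrix_vector_mul_assoc Yi)
  then have "v \<noteq> 0" using w(1) by auto
  then have posv: "0 < quad_form Y v" using posdefD(2)[OF Y] by blast
  define u where "u = (1 / sqrt (quad_form Y v)) *\<^sub>R v"
  have quu: "quad_form Y u = 1"
    using posv unfolding u_def quad_form_scaleR by (simp add: power_divide)
  have orth: "u \<bullet> (Y *v x) = 0" if "x \<in> ?X" for x
  proof -
    have "v \<bullet> (Y *v x) = x \<bullet> w"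
      using symmetric_form_commute[OF symY, of v x] Yv by simp
    also have "\<dots> = 0" using w(2)[OF span_base[OF that]] by (simp add: orthogonal_def inner_commute)
    finally show ?thesis by (simp add: u_def)
  qed
  define T where "T = (\<lambda>j. (sqrt c * real j) *\<^sub>R u) ` {..<N}"
  have "u \<noteq> 0" using quu by (auto simp: quad_form_def)
  then have cardT: "card T = N"
    unfolding T_def using \<open>0 < c\<close> by (subst card_image) (auto simp: inj_on_def)
  have "real (card T) * measure lebesgue (ball (0::real^'m) (sqrt c / 2)) \<le> sqrt (det Y)"
  proof (rule lattice_packing_bound[OF Y])
    fix s t :: "real^'m" and a :: "int^'m"
    assume "s \<in> T" "t \<in> T" and small: "quad_form Y (s - t + real_vec_of_int a) < 4 * (sqrt c / 2)\<^sup>2"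
    then obtain j k where jk: "j < N" "k < N" "s = (sqrt c * real j) *\<^sub>R u" "t = (sqrt c * real k) *\<^sub>R u"
      by (auto simp: T_def)
    define \<tau> where "\<tau> = sqrt c * (real j - real k)"
    let ?a = "real_vec_of_int a"
    have st: "s - t = \<tau> *\<^sub>R u" by (simp add: jk \<tau>_def algebra_simps)
    have \<tau>2: "\<tau>\<^sup>2 = c * (real j - real k)\<^sup>2" using \<open>0 < c\<close> by (simp add: \<tau>_def power_mult_distrib)
    have small': "quad_form Y (\<tau> *\<^sub>R u + ?a) < c" using small st \<open>0 < c\<close> by (simp add: power_divide)
    have short: "?a \<in> ?X"
    proof -
      have "(real j - real k)\<^sup>2 \<le> (real N)\<^sup>2" using jk(1,2) by (intro abs_le_square_iff[THEN iffD1]) auto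
      then have "\<tau>\<^sup>2 \<le> c * (real N)\<^sup>2" using \<tau>2 \<open>0 < c\<close> by simp
      moreover have "quad_form Y (\<tau> *\<^sub>R u) = \<tau>\<^sup>2" using quu by (simp add: quad_form_scaleR)
      moreover have "quad_form Y ?a \<le> 2 * quad_form Y (\<tau> *\<^sub>R u + ?a) + 2 * quad_form Y (\<tau> *\<^sub>R u)"
      proof -
        \<comment> \<open>This is the parallelogram law for the vectors \<open>\<tau> u + a\<close> and \<open>\<tau> u\<close>.\<close>
        have "0 \<le> quad_form Y (2 *\<^sub>R (\<tau> *\<^sub>R u) + ?a)" using posdefD(3)[OF Y] .
        then show ?thesis
          by (simp only: quad_form_add[OF symY] quad_form_scaleR) (simp add: power2_eq_square algebra_simps)
      qed
      ultimately have "quad_form Y ?a \<le> 2 * c * (1 + (real N)\<^sup>2)"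
        using small' by (simp add: algebra_simps)
      then show ?thesis by blast
    qed
    have "quad_form Y (\<tau> *\<^sub>R u + ?a) = \<tau>\<^sup>2 + quad_form Y ?a"
      using orth[OF short] quu by (simp add: quad_form_add[OF symY] quad_form_scaleR)
    then have sum: "c * (real j - real k)\<^sup>2 + quad_form Y ?a < c" using small' \<tau>2 by simp
    have "0 \<le> c * (real j - real k)\<^sup>2" using \<open>0 < c\<close> by simp
    then have a0: "a = 0" using sum min[of a] by force
    have "c * (real j - real k)\<^sup>2 < c * 1" using sum posdefD(3)[OF Y, of ?a] by linarith
    then have "(real j - real k)\<^sup>2 < 1\<^sup>2" using \<open>0 < c\<close> by (simp only: mult_less_cancel_left_pos) simp
    then have "\<bar>real j - real k\<bar> < 1" by (metis abs_one power2_less_imp_less abs_ge_zero power2_abs zero_le_one)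
    then have "j = k" by linarith
    then show "s = t \<and> a = 0" using a0 jk by simp
  qed (use \<open>0 < c\<close> in \<open>auto simp: T_def\<close>)
  then show False using N cardT by simp
qed

lemma integer_frame:
  fixes X :: "(int^'m) set"
  assumes "span (real_vec_of_int ` X) = UNIV"
  obtains V :: "int^'m^'m" where "invertible (real_mat_of_int V)" and "\<And>j. column j V \<in> X"
proof -
  obtain B where B: "B \<subseteq> real_vec_of_int ` X" "independent B" "real_vec_of_int ` X \<subseteq> span B"
    using maximal_independent_subset by blast
  then have spB: "span B = UNIV"
    using assms span_mono[OF B(3)] by (simp add: span_span top.extremum_unique)
  have "finite B" using B(2) independent_bound by blast
  moreover have "card B = CARD('m)"
    using dim_span_eq_card_independent[OF B(2)] spB by simp
  ultimately obtain f where f: "bij_betw f (UNIV :: 'm set) B"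
    using finite_same_card_bij[of "UNIV :: 'm set" B] by auto
  then have "\<forall>j. \<exists>a. a \<in> X \<and> f j = real_vec_of_int a"
    using B(1) by (auto simp: bij_betw_def)
  then obtain g where g: "\<And>j. g j \<in> X" "\<And>j. f j = real_vec_of_int (g j)" by metis
  define V :: "int^'m^'m" where "V = (\<chi> i j. g j $ i)"
  have colV: "column j V = g j" for j by (simp add: V_def column_def)
  have "column j (real_mat_of_int V) = f j" for j
    by (simp add: V_def column_def g real_mat_of_int_def real_vec_of_int_def)
  then have "columns (real_mat_of_int V) = B"
    using f by (auto simp: columns_def bij_betw_def)
  then have "invertible (real_mat_of_int V)"
    using matrix_right_invertible_span_columns[of "real_mat_of_int V"] spB
    by (simp add: invertible_right_inverse span_vec_eq)
  then show ?thesis using that colV g(1) by metis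
qed

section \<open>Compact sets of positive definite forms\<close>

lemma matrix_vector_mult_uminus: "(A::real^'m^'k) *v (- x) = - (A *v x)"
  using matrix_vector_mult_scaleR[of A "-1" x] by simp

lemma psd_kernel:
  fixes Z :: "real^'m^'m"
  assumes "transpose Z = Z" and psd: "\<And>x. 0 \<le> quad_form Z x" and "quad_form Z x = 0"
  shows "Z *v x = 0"
proof (rule ccontr)
  assume "Z *v x \<noteq> 0"
  define y where "y = Z *v x"
  define p where "p = y \<bullet> y"
  define q where "q = quad_form Z y"
  have "0 < p" using \<open>Z *v x \<noteq> 0\<close> by (simp add: p_def y_def)
  have "0 \<le> q" unfolding q_def by (rule psd)
  \<comment> \<open>Along the line \<open>x - t y\<close> the form is \<open>t\<^sup>2 q - 2 t p\<close>, which is negative for small \<open>t > 0\<close>.\<close>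
  define t where "t = p / (q + 1)"
  have "0 < t" using \<open>0 < p\<close> \<open>0 \<le> q\<close> by (simp add: t_def)
  have "y \<bullet> (Z *v x) = p" by (simp add: p_def y_def)
  then have "x \<bullet> (Z *v y) = p" using symmetric_form_commute[OF assms(1)] by metis
  then have "quad_form Z (x + (- t) *\<^sub>R y) = - 2 * t * p + t\<^sup>2 * q"
    using assms(3) unfolding quad_form_add[OF assms(1)] quad_form_scaleR
    by (simp add: q_def matrix_vector_mult_scaleR matrix_vector_mult_uminus)
  also have "\<dots> = t * (t * q - 2 * p)" by (simp add: power2_eq_square algebra_simps)
  also have "\<dots> < 0"
  proof -
    have "t * q \<le> t * (q + 1)" using \<open>0 < t\<close> by (simp add: algebra_simps)
    also have "\<dots> = p" using \<open>0 \<le> q\<close> by (simp add: t_def)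
    finally have "t * q - 2 * p < 0" using \<open>0 < p\<close> by simp
    then show ?thesis using \<open>0 < t\<close> by (simp add: mult_pos_neg)
  qed
  finally show False using psd by (metis not_less)
qed

text \<open>
  All conditions are closed and bounded, and the semidefiniteness and the bound on the determinant
  together force positive definiteness. So these are compact subsets of the cone of positive definite matrices.
\<close>

definition bounded_forms :: "real \<Rightarrow> real \<Rightarrow> (real^'m^'m) set" where
  "bounded_forms b v = {Z. transpose Z = Z \<and> (\<forall>x. 0 \<le> quad_form Z x) \<and> (\<forall>i j. \<bar>Z $ i $ j\<bar> \<le> b) \<and> v \<le> det Z}"

lemma bounded_forms_posdef:
  assumes "0 < v"
  shows "(bounded_forms b v :: (real^'m^'m) set) \<subseteq> posdef_mats"
proof
  fix Z :: "real^'m^'m" assume Z: "Z \<in> bounded_forms b v"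
  then have "invertible Z" using assms invertible_det_nz[of Z] by (auto simp: bounded_forms_def)
  then have "Z *v x \<noteq> 0" if "x \<noteq> 0" for x
    using that by (metis invertible_left_inverse matrix_left_invertible_ker)
  then have "quad_form Z x \<noteq> 0" if "x \<noteq> 0" for x
    using psd_kernel[of Z x] Z that by (auto simp: bounded_forms_def)
  then show "Z \<in> posdef_mats"
    using Z unfolding posdef_mats_def bounded_forms_def quad_form_def by (auto simp: less_le)
qed

lemma continuous_on_det_matrix: "continuous_on S (\<lambda>Z::real^'m^'m. det Z)"
  unfolding det_def by (intro continuous_intros)

lemma continuous_on_matrix_mult:
  fixes f :: "'a::topological_space \<Rightarrow> real^'k^'m" and g :: "'a \<Rightarrow> real^'l^'k"
  assumes "continuous_on S f" "continuous_on S g"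
  shows "continuous_on S (\<lambda>x. f x ** g x)"
  unfolding matrix_matrix_mult_def
  by (intro continuous_intros assms)

lemma continuous_on_mat_act: "continuous_on S (\<lambda>Z. mat_act Z G)"
  unfolding mat_act_def by (intro continuous_on_matrix_mult continuous_intros)

lemma continuous_on_quad_form: "continuous_on S (\<lambda>Z. quad_form Z x)"
  unfolding quad_form_def matrix_vector_mult_def inner_vec_def
  by (intro continuous_intros)

lemma matrix_norm_le:
  fixes Z :: "real^'m^'k"
  assumes "\<And>i j. \<bar>Z $ i $ j\<bar> \<le> b"
  shows "norm Z \<le> real CARD('k) * (real CARD('m) * b)"
proof -
  have "norm (Z $ i) \<le> real CARD('m) * b" for i
    using norm_le_l1_cart[of "Z $ i"] sum_bounded_above[of UNIV "\<lambda>j. \<bar>Z $ i $ j\<bar>" b] assms by force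
  then have "(\<Sum>i\<in>UNIV. norm (Z $ i)) \<le> real CARD('k) * (real CARD('m) * b)"
    using sum_bounded_above[of UNIV "\<lambda>i. norm (Z $ i)" "real CARD('m) * b"] by simp
  moreover have "norm Z \<le> (\<Sum>i\<in>UNIV. norm (Z $ i))"
    unfolding norm_vec_def by (rule L2_set_le_sum) simp
  ultimately show ?thesis by linarith
qed

lemma compact_bounded_forms: "compact (bounded_forms b v :: (real^'m^'m) set)"
proof -
  have "closed (bounded_forms b v :: (real^'m^'m) set)"
    unfolding bounded_forms_def transpose_def
    by (intro closed_Collect_conj closed_Collect_all closed_Collect_le closed_Collect_eq
        continuous_on_quad_form continuous_on_det_matrix continuous_intros)
  moreover have "bounded (bounded_forms b v :: (real^'m^'m) set)"
    unfolding bounded_iff bounded_forms_def using matrix_norm_le by blast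
  ultimately show ?thesis by (simp add: compact_eq_bounded_closed)
qed

text \<open>
  The off-diagonal entries are controlled by the values of the form at \<open>e\<^sub>i + e\<^sub>j\<close> and \<open>e\<^sub>i - e\<^sub>j\<close>.
\<close>

lemma psd_entry_bound:
  fixes Z :: "real^'m^'m"
  assumes sym: "transpose Z = Z" and psd: "\<And>x. 0 \<le> quad_form Z x"
    and diag: "\<And>i. quad_form Z (axis i 1) \<le> b"
  shows "\<bar>Z $ i $ j\<bar> \<le> b"
proof -
  have "0 \<le> quad_form Z (axis i 1 + axis j 1)" "0 \<le> quad_form Z (axis i 1 + (-1) *\<^sub>R axis j 1)"
    by (rule psd)+
  then show ?thesis
    unfolding quad_form_add[OF sym] quad_form_scaleR
    using diag[of i] diag[of j] by (simp add: matrix_entry_inner[of Z i j] matrix_vector_mult_uminus abs_le_iff)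
qed

section \<open>Finitely many lattices of bounded index\<close>

lemma real_mat_of_int_mult: "real_mat_of_int (U ** V) = real_mat_of_int U ** real_mat_of_int V"
  by (simp add: real_mat_of_int_def matrix_matrix_mult_def vec_eq_iff)

lemma real_mat_of_int_vec: "real_mat_of_int V *v real_vec_of_int x = real_vec_of_int (V *v x)"
  by (simp add: real_mat_of_int_def real_vec_of_int_def matrix_vector_mult_def vec_eq_iff)

lemma real_mat_of_int_1: "real_mat_of_int (mat 1) = mat 1"
  by (simp add: real_mat_of_int_def mat_def vec_eq_iff)

lemma real_mat_of_int_inject: "real_mat_of_int U = real_mat_of_int V \<longleftrightarrow> U = V"
  by (simp add: real_mat_of_int_def vec_eq_iff)

lemma det_real_mat_of_int: "det (real_mat_of_int V) = of_int (det V)"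
  by (simp add: real_mat_of_int_def det_def)

lemma integral_matrixE:
  fixes A :: "real^'m^'m"
  assumes "\<And>i j. A $ i $ j \<in> \<int>"
  obtains U where "A = real_mat_of_int U"
proof
  show "A = real_mat_of_int (\<chi> i j. \<lfloor>A $ i $ j\<rfloor>)"
    using assms by (simp add: real_mat_of_int_def vec_eq_iff)
qed

lemma invertible_if_real_inverse:
  assumes "real_mat_of_int U ** real_mat_of_int W = mat 1"
    and "real_mat_of_int W ** real_mat_of_int U = mat 1"
  shows "invertible U"
  unfolding invertible_def
  using assms by (metis real_mat_of_int_mult real_mat_of_int_1 real_mat_of_int_inject)

text \<open>
  By Cramer's rule the adjugate matrix has integer entries; \<open>x\<close> is its \<open>k\<close>-th column.
\<close>

lemma integer_cramer:
  fixes V :: "int^'m^'m"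
  assumes "det V \<noteq> 0"
  obtains x where "real_mat_of_int V *v real_vec_of_int x = real_of_int (det V) *\<^sub>R axis k 1"
proof -
  let ?R = "real_mat_of_int V" and ?d = "real_of_int (det V)"
  define x :: "int^'m" where
    "x = (\<chi> l. det (\<chi> i j. if j = l then (if i = k then 1 else 0) else V $ i $ j))"
  have "det (\<chi> i j. if j = l then axis k 1 $ i else ?R $ i $ j) = real_of_int (x $ l)" for l
    unfolding x_def vec_lambda_beta det_real_mat_of_int[symmetric]
    by (rule arg_cong[of _ _ det]) (simp add: vec_eq_iff real_mat_of_int_def axis_def)
  then have "?R *v (\<chi> l. real_of_int (x $ l) / ?d) = axis k 1"
    using cramer[of ?R "\<chi> l. real_of_int (x $ l) / ?d" "axis k 1"] assms
    by (simp add: det_real_mat_of_int)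
  moreover have "real_vec_of_int x = ?d *\<^sub>R (\<chi> l. real_of_int (x $ l) / ?d)"
    using assms by (simp add: real_vec_of_int_def vec_eq_iff)
  ultimately show ?thesis
    using that[of x] by (simp add: matrix_vector_mult_scaleR)
qed

text \<open>
  The second component encodes the lattice \<open>V\<^sup>-\<^sup>1 \<int>\<^sup>m\<close>, scaled by \<open>det V\<close> so as to lie in \<open>\<int>\<^sup>m\<close> and
  reduced modulo \<open>det V\<close> so as to become a finite set. It determines \<open>V\<close> up to unimodular factors on the left.
\<close>

definition lattice_key :: "int^'m^'m \<Rightarrow> int \<times> (int^'m) set" where
  "lattice_key V = (\<bar>det V\<bar>, {x. \<forall>i. x $ i \<in> {0..<\<bar>det V\<bar>} \<and> det V dvd (V *v x) $ i})"

lemma finite_lattice_keys: "finite (lattice_key ` {V :: int^'m^'m. \<bar>det V\<bar> \<le> N})"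
proof (rule finite_subset)
  show "lattice_key ` {V :: int^'m^'m. \<bar>det V\<bar> \<le> N}
      \<subseteq> (SIGMA D:{0..N}. Pow {x. \<forall>i. x $ i \<in> {0..<D}})"
    by (auto simp: lattice_key_def)
  show "finite (SIGMA D:{0..N}. Pow {x :: int^'m. \<forall>i. x $ i \<in> {0..<D}})"
    by (intro finite_SigmaI) (simp_all only: finite_Pow_iff finite_vecs_componentwise finite_atLeastAtMost_int finite_atLeastLessThan_int)
qed

text \<open>
  The congruence \<open>W x \<equiv> 0\<close> modulo \<open>det W\<close> only depends on the residue of \<open>x\<close>, and the keys compare the
  congruences for \<open>V\<close> and \<open>W\<close> on a full system of residues.
\<close>

lemma lattice_key_dvd:
  fixes V W :: "int^'m^'m"
  assumes key: "lattice_key V = lattice_key W" and W: "det W \<noteq> 0"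
    and x: "\<And>i. det W dvd (W *v x) $ i"
  shows "det V dvd (V *v x) $ i"
proof -
  define D where "D = \<bar>det W\<bar>"
  have D: "0 < D" "D = \<bar>det V\<bar>" using W key by (auto simp: D_def lattice_key_def)
  define y q where "y = (\<chi> i. x $ i mod D)" and "q = (\<chi> i. x $ i div D)"
  have xyq: "x = y + D *s q"
    by (simp add: y_def q_def vec_eq_iff)
  have comp: "(A *v x) $ i = (A *v y) $ i + D * (A *v q) $ i" for A :: "int^'m^'m" and i
    unfolding xyq by (simp add: matrix_vector_mult_def sum.distrib sum_distrib_left algebra_simps)
  have "det W dvd (W *v y) $ i" for i
    using x[of i] comp[of W i] by (simp add: D_def dvd_add_left_iff)
  then have "y \<in> snd (lattice_key W)"
    using D by (simp add: lattice_key_def y_def D_def[symmetric])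
  then have "y \<in> snd (lattice_key V)" using key by simp
  then have "det V dvd (V *v y) $ i" by (simp add: lattice_key_def)
  then show ?thesis
    using comp[of V i] D(2) by simp
qed

text \<open>
  The columns of \<open>V W\<^sup>-\<^sup>1\<close> are \<open>V x / det W\<close> with \<open>x\<close> a column of the adjugate of \<open>W\<close>. Since \<open>W x\<close> is
  divisible by \<open>det W\<close>, so is \<open>V x\<close>.
\<close>

lemma lattice_key_factor:
  fixes V W :: "int^'m^'m"
  assumes key: "lattice_key V = lattice_key W" and W: "det W \<noteq> 0"
  obtains U where "real_mat_of_int V = real_mat_of_int U ** real_mat_of_int W"
proof -
  let ?V = "real_mat_of_int V" and ?W = "real_mat_of_int W"
  let ?d = "real_of_int (det W)"
  have "invertible ?W" using W by (simp add: invertible_det_nz det_real_mat_of_int)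
  then obtain Wi where Wi: "?W ** Wi = mat 1" "Wi ** ?W = mat 1" by (auto simp: invertible_def)
  have dV: "\<bar>det V\<bar> = \<bar>det W\<bar>" using key by (simp add: lattice_key_def)
  have "(?V ** Wi) $ i $ k \<in> \<int>" for i k
  proof -
    obtain x where x: "?W *v real_vec_of_int x = ?d *\<^sub>R axis k 1"
      using integer_cramer[OF W] .
    then have "real_of_int ((W *v x) $ j) = ?d * (axis k 1 $ j)" for j
      by (metis real_mat_of_int_vec real_vec_of_int_def vec_lambda_beta vector_scaleR_component real_scaleR_def)
    then have "real_of_int ((W *v x) $ j) = real_of_int (det W * (if j = k then 1 else 0))" for j
      by (simp add: axis_def)
    then have "(W *v x) $ j = det W * (if j = k then 1 else 0)" for j
      by (simp only: of_int_eq_iff)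
    then have "det W dvd (W *v x) $ j" for j by simp
    then have "det V dvd (V *v x) $ i" by (rule lattice_key_dvd[OF key W])
    then have "det W dvd (V *v x) $ i" using dV by (metis dvd_abs_iff abs_dvd_iff)
    then obtain q where q: "(V *v x) $ i = det W * q" by blast
    have "?d *\<^sub>R (Wi *v axis k 1) = real_vec_of_int x"
      using arg_cong[OF x, of "\<lambda>z. Wi *v z"]
      by (simp add: matrix_vector_mul_assoc Wi matrix_vector_mult_scaleR)
    then have "?d *\<^sub>R ((?V ** Wi) *v axis k 1) = real_vec_of_int (V *v x)"
      by (metis matrix_vector_mul_assoc matrix_vector_mult_scaleR real_mat_of_int_vec)
    then have "?d * (?V ** Wi) $ i $ k = real_of_int (det W * q)"
      using q by (simp add: vec_eq_iff real_vec_of_int_def matrix_vector_mult_basis column_def)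
    then have "(?V ** Wi) $ i $ k = real_of_int q" using W by simp
    then show ?thesis by simp
  qed
  then obtain U where "?V ** Wi = real_mat_of_int U" by (rule integral_matrixE)
  then have "real_mat_of_int U ** ?W = ?V" by (metis Wi(2) matrix_mul_assoc matrix_mul_rid)
  then show ?thesis using that by metis
qed

lemma lattice_key_unimodular:
  fixes V W :: "int^'m^'m"
  assumes key: "lattice_key V = lattice_key W" and "det V \<noteq> 0" "det W \<noteq> 0"
  obtains U where "invertible U" "real_mat_of_int V = real_mat_of_int U ** real_mat_of_int W"
proof -
  obtain U where U: "real_mat_of_int V = real_mat_of_int U ** real_mat_of_int W"
    using lattice_key_factor[OF key assms(3)] .
  obtain U' where U': "real_mat_of_int W = real_mat_of_int U' ** real_mat_of_int V"
    using lattice_key_factor[OF key[symmetric] assms(2)] .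
  have cancel: "A = mat 1" if "A ** real_mat_of_int X = real_mat_of_int X" "det X \<noteq> 0"
    for A :: "real^'m^'m" and X :: "int^'m^'m"
  proof -
    have "invertible (real_mat_of_int X)" using that by (simp add: invertible_det_nz det_real_mat_of_int)
    then show ?thesis using that(1) by (metis invertible_def matrix_mul_assoc matrix_mul_rid)
  qed
  have "real_mat_of_int U ** real_mat_of_int U' = mat 1"
    by (rule cancel[of _ V]) (metis U U' matrix_mul_assoc, fact assms(2))
  moreover have "real_mat_of_int U' ** real_mat_of_int U = mat 1"
    by (rule cancel[of _ W]) (metis U U' matrix_mul_assoc, fact assms(3))
  ultimately have "invertible U" by (rule invertible_if_real_inverse)
  then show ?thesis using that U by blast
qed

section \<open>Eigenvalues of a skew form relative to an inner product\<close>

lemma poly_det: "poly (det (M :: 'a::comm_ring_1 poly^'m^'m)) z = det (\<chi> i j. poly (M $ i $ j) z)"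
  by (simp add: det_def poly_sum poly_prod)

lemma poly_charpoly: "poly (charpoly A) z = det (mat z - A)"
proof -
  have "(\<chi> i j. poly ((mat [:0, 1:] - (\<chi> i j. [:A $ i $ j:])) $ i $ j) z) = mat z - A"
    by (simp add: vec_eq_iff mat_def)
  then show ?thesis by (simp add: charpoly_def poly_det)
qed

text \<open>
  In the expansion of the determinant only the identity permutation contributes to the degree \<open>CARD('m)\<close>;
  every other permutation meets an off-diagonal, hence constant, entry.
\<close>

lemma degree_charpoly: "degree (charpoly (A :: complex^'m^'m)) = CARD('m)"
proof -
  define M where "M = mat [:0, 1:] - (\<chi> i j. [:A $ i $ j:] :: complex poly^'m^'m)"
  define g where "g p = of_int (sign p) * (\<Prod>i\<in>UNIV. M $ i $ p i)" for p
  define S where "S = {p. p permutes (UNIV :: 'm set)}"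
  have M: "M $ i $ j = (if i = j then [:- A $ i $ i, 1:] else [:- A $ i $ j:])" for i j
    by (simp add: M_def mat_def)
  have "finite S" unfolding S_def by (rule finite_permutations) simp
  have id: "id \<in> S" by (simp add: S_def permutes_id)
  have gid: "degree (g id) = CARD('m)"
    by (simp add: g_def sign_id M degree_prod_eq_sum_degree)
  have "degree (g p) < CARD('m)" if "p \<in> S - {id}" for p
  proof -
    have k: "\<exists>a. a \<noteq> p a" using \<open>p \<in> S - {id}\<close> by (metis DiffD2 eq_id_iff insertI1)
    have "degree (g p) \<le> degree (\<Prod>i\<in>UNIV. M $ i $ p i)"
      unfolding g_def by (rule order.trans[OF degree_mult_le]) simp
    also have "\<dots> \<le> (\<Sum>i\<in>UNIV. degree (M $ i $ p i))"
      using degree_prod_sum_le[of UNIV "\<lambda>i. M $ i $ p i"] by (simp add: o_def)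
    also have "\<dots> < (\<Sum>i\<in>(UNIV :: 'm set). 1)"
      by (rule sum_strict_mono_ex1) (use k in \<open>auto simp: M\<close>)
    finally show ?thesis by simp
  qed
  then have "degree (\<Sum>p\<in>S - {id}. g p) < CARD('m)"
    by (intro degree_sum_less) auto
  then have "degree (g id + (\<Sum>p\<in>S - {id}. g p)) = CARD('m)"
    using gid by (subst degree_add_eq_left) auto
  also have "g id + (\<Sum>p\<in>S - {id}. g p) = charpoly A"
    using sum.remove[OF \<open>finite S\<close> id, of g]
    by (simp add: charpoly_def det_def g_def S_def M_def)
  finally show ?thesis .
qed

lemma charpoly_nonzero: "charpoly (A :: complex^'m^'m) \<noteq> 0"
  by (metis degree_charpoly degree_0 zero_less_card_finite less_irrefl)

abbreviation complex_mat :: "real^'m^'m \<Rightarrow> complex^'m^'m" where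
  "complex_mat A \<equiv> (\<chi> i j. complex_of_real (A $ i $ j))"

text \<open>
  Eigenvectors of a real matrix are handled through their real and imaginary parts \<open>x\<close> and \<open>y\<close>.
\<close>

lemma charpoly_root_iff:
  fixes A :: "real^'m^'m"
  shows "poly (charpoly (complex_mat A)) z = 0 \<longleftrightarrow>
    (\<exists>x y. (x \<noteq> 0 \<or> y \<noteq> 0) \<and> A *v x = Re z *\<^sub>R x - Im z *\<^sub>R y \<and> A *v y = Im z *\<^sub>R x + Re z *\<^sub>R y)"
    (is "_ \<longleftrightarrow> (\<exists>x y. ?E x y)")
proof -
  let ?A = "complex_mat A"
  have ker: "(mat z - ?A) *v w = 0 \<longleftrightarrow>
      A *v (\<chi> i. Re (w $ i)) = Re z *\<^sub>R (\<chi> i. Re (w $ i)) - Im z *\<^sub>R (\<chi> i. Im (w $ i)) \<and>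
      A *v (\<chi> i. Im (w $ i)) = Im z *\<^sub>R (\<chi> i. Re (w $ i)) + Re z *\<^sub>R (\<chi> i. Im (w $ i))" for w
  proof -
    have "(mat z - ?A) *v w = z *s w - ?A *v w"
      by (simp add: matrix_vector_mult_diff_rdistrib) (simp add: vec_eq_iff matrix_vector_mult_def mat_def if_distrib if_distribR cong: if_cong)
    then show ?thesis
      by (simp only:) (auto simp: vec_eq_iff complex_eq_iff matrix_vector_mult_def algebra_simps)
  qed
  have "poly (charpoly ?A) z = 0 \<longleftrightarrow> \<not> invertible (mat z - ?A)"
    by (simp add: poly_charpoly invertible_det_nz)
  also have "\<dots> \<longleftrightarrow> (\<exists>w. w \<noteq> 0 \<and> (mat z - ?A) *v w = 0)"
    unfolding invertible_left_inverse matrix_left_invertible_ker by blast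
  also have "\<dots> \<longleftrightarrow> (\<exists>x y. ?E x y)"
  proof
    assume "\<exists>w. w \<noteq> 0 \<and> (mat z - ?A) *v w = 0"
    then obtain w where w: "w \<noteq> 0" "(mat z - ?A) *v w = 0" by blast
    from w(1) have "(\<chi> i. Re (w $ i)) \<noteq> 0 \<or> (\<chi> i. Im (w $ i)) \<noteq> 0"
      by (auto simp: vec_eq_iff complex_eq_iff)
    then show "\<exists>x y. ?E x y" using w(2)[unfolded ker] by blast
  next
    assume "\<exists>x y. ?E x y"
    then obtain x y where xy: "?E x y" by blast
    define w where "w = (\<chi> i. Complex (x $ i) (y $ i))"
    have [simp]: "(\<chi> i. Re (w $ i)) = x" "(\<chi> i. Im (w $ i)) = y" by (simp_all add: w_def vec_eq_iff)
    have "w \<noteq> 0" using xy by (auto simp: w_def vec_eq_iff complex_eq_iff)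
    moreover have "(mat z - ?A) *v w = 0" using xy by (simp add: ker)
    ultimately show "\<exists>w. w \<noteq> 0 \<and> (mat z - ?A) *v w = 0" by blast
  qed
  finally show ?thesis .
qed

lemma order_cnj_le:
  fixes p :: "complex poly"
  assumes real: "\<And>x. cnj (poly p (cnj x)) = poly p x" and "p \<noteq> 0"
  shows "order a p \<le> order (cnj a) p"
proof -
  define k where "k = order a p"
  obtain q where q: "p = [:- a, 1:] ^ k * q"
    using order_1[of a p] by (auto simp: dvd_def k_def)
  have "poly p x = poly ([:- cnj a, 1:] ^ k * map_poly cnj q) x" for x
  proof -
    have "poly p (cnj x) = (cnj x - a) ^ k * poly q (cnj x)" by (subst q) simp
    then have "cnj (poly p (cnj x)) = (x - cnj a) ^ k * cnj (poly q (cnj x))" by simp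
    then show ?thesis using real[of x] by simp
  qed
  then have "p = [:- cnj a, 1:] ^ k * map_poly cnj q"
    using poly_eq_poly_eq_iff by blast
  then have "[:- cnj a, 1:] ^ k dvd p" by (metis dvd_triv_left)
  then show ?thesis using order_divides \<open>p \<noteq> 0\<close> by (auto simp: k_def)
qed

lemma poly_charpoly_real: "cnj (poly (charpoly (complex_mat A)) (cnj z)) = poly (charpoly (complex_mat A)) z"
proof -
  have cnj_det: "cnj (det M) = det (\<chi> i j. cnj (M $ i $ j))" for M :: "complex^'m^'m"
    by (simp add: det_def)
  have "(\<chi> i j. cnj ((mat (cnj z) - complex_mat A) $ i $ j)) = mat z - complex_mat A"
    by (simp add: vec_eq_iff mat_def)
  then show ?thesis by (simp only: poly_charpoly cnj_det)
qed

lemma proots_charpoly_cnj: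
  "image_mset cnj (proots (charpoly (complex_mat A))) = proots (charpoly (complex_mat (A :: real^'m^'m)))"
    (is "image_mset cnj (proots ?p) = _")
proof (rule multiset_eqI)
  fix z
  have p0: "?p \<noteq> 0" by (rule charpoly_nonzero)
  have "order z ?p = order (cnj z) ?p"
    using order_cnj_le[OF poly_charpoly_real p0, of z] order_cnj_le[OF poly_charpoly_real p0, of "cnj z"] by simp
  moreover have "{y. y \<in># proots ?p \<and> z = cnj y} = (if cnj z \<in># proots ?p then {cnj z} else {})"
    by auto
  then have "count (image_mset cnj (proots ?p)) z = count (proots ?p) (cnj z)"
    by (auto simp: count_image_mset' not_in_iff simp del: count_proots set_count_proots)
  ultimately show "count (image_mset cnj (proots ?p)) z = count (proots ?p) z" using p0 by simp
qed

text \<open>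
  Complex conjugation permutes the roots with multiplicity, so without real roots exactly half of them lie in
  the upper half plane.
\<close>

lemma size_upper_roots:
  fixes A :: "real^'m^'m"
  assumes nonreal: "\<And>z. poly (charpoly (complex_mat A)) z = 0 \<Longrightarrow> Im z \<noteq> 0"
  shows "2 * size (filter_mset (\<lambda>z. 0 < Im z) (proots (charpoly (complex_mat A)))) = CARD('m)"
proof -
  define R where "R = proots (charpoly (complex_mat A))"
  have p0: "charpoly (complex_mat A) \<noteq> 0" by (rule charpoly_nonzero)
  have "CARD('m) = size R" unfolding R_def size_proots_complex degree_charpoly ..
  also have "R = filter_mset (\<lambda>z. 0 < Im z) R + filter_mset (\<lambda>z. \<not> 0 < Im z) R"
    by (rule multiset_partition)
  also have "filter_mset (\<lambda>z. \<not> 0 < Im z) R = filter_mset (\<lambda>z. Im z < 0) R"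
  proof (rule filter_mset_cong[OF refl])
    fix z assume "z \<in># R"
    then have "Im z \<noteq> 0" using nonreal p0 by (simp add: R_def)
    then show "(\<not> 0 < Im z) = (Im z < 0)" by linarith
  qed
  also have "\<dots> = image_mset cnj (filter_mset (\<lambda>z. 0 < Im z) R)"
  proof -
    have "filter_mset (\<lambda>z. Im z < 0) R = filter_mset (\<lambda>z. Im z < 0) (image_mset cnj R)"
      unfolding R_def proots_charpoly_cnj ..
    then show ?thesis by (simp add: filter_mset_image_mset)
  qed
  finally show ?thesis by (simp add: R_def)
qed

lemma sum_UNIV_Plus:
  "(\<Sum>i\<in>UNIV. f i) = (\<Sum>k\<in>UNIV. f (Inl (k :: 'a::finite))) + (\<Sum>k\<in>UNIV. f (Inr (k :: 'b::finite)))"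
  unfolding UNIV_Plus_UNIV[symmetric] by (subst sum.Plus) simp_all

lemma symp_J_mult_vec:
  fixes x :: "real^('n::finite + 'n)"
  shows "(symp_J *v x) $ Inl k = x $ Inr k" and "(symp_J *v x) $ Inr k = - x $ Inl k"
  by (simp_all add: matrix_vector_mult_def symp_J_def sum_UNIV_Plus if_distrib if_distribR cong: if_cong)

lemma symp_J_injective: "symp_J *v x = 0 \<Longrightarrow> x = 0"
proof -
  assume J: "symp_J *v x = 0"
  have "x $ i = 0" for i
    using symp_J_mult_vec[of x] J by (cases i) (metis zero_index neg_equal_0_iff_equal)+
  then show "x = 0" by (simp add: vec_eq_iff)
qed

lemma transpose_symp_J: "transpose symp_J = - symp_J"
  by (auto simp: transpose_def symp_J_def vec_eq_iff split: sum.split)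

lemma uminus_matrix_vector_mult: "(- A :: real^'m^'k) *v x = - (A *v x)"
  using matrix_vector_mult_diff_rdistrib[of 0 A x] by simp

lemma symp_J_alternating: "x \<bullet> (symp_J *v y) = - (y \<bullet> (symp_J *v x))"
proof -
  have "x \<bullet> (symp_J *v y) = (- symp_J *v x) \<bullet> y"
    unfolding transpose_symp_J[symmetric] by (rule inner_matrix_vector)
  then show ?thesis
    by (simp only: uminus_matrix_vector_mult inner_minus_left inner_commute[of y])
qed

lemma matrix_inv_inverse: "invertible A \<Longrightarrow> A ** matrix_inv A = mat 1 \<and> matrix_inv A ** A = mat 1"
  unfolding matrix_inv_def invertible_def by (rule someI_ex)

lemma posdef_invertible: "Y \<in> posdef_mats \<Longrightarrow> invertible (Y :: real^'m^'m)"
  using posdef_det_pos[of Y] invertible_det_nz[of Y] by auto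

text \<open>
  With respect to the inner product \<open>Y\<close> the matrix \<open>Y\<^sup>-\<^sup>1 J\<close> is skew, because \<open>Y (Y\<^sup>-\<^sup>1 J) = J\<close> is. It is
  injective because \<open>J\<close> is.
\<close>

lemma eigenvalue_purely_imaginary:
  fixes Y :: "real^('n::finite + 'n)^('n + 'n)"
  assumes Y: "Y \<in> posdef_mats"
    and z: "poly (charpoly (complex_mat (matrix_inv Y ** symp_J))) z = 0"
  shows "Re z = 0" and "Im z \<noteq> 0"
proof -
  let ?A = "matrix_inv Y ** symp_J"
  have inv: "Y ** matrix_inv Y = mat 1"
    using matrix_inv_inverse[OF posdef_invertible[OF Y]] by blast
  have YA: "Y *v (?A *v x) = symp_J *v x" for x
    by (simp add: matrix_vector_mul_assoc matrix_mul_assoc inv)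
  obtain x y where xy: "x \<noteq> 0 \<or> y \<noteq> 0"
      "?A *v x = Re z *\<^sub>R x - Im z *\<^sub>R y" "?A *v y = Im z *\<^sub>R x + Re z *\<^sub>R y"
    using z unfolding charpoly_root_iff by blast
  have J0: "v \<bullet> (symp_J *v v) = 0" for v :: "real^('n + 'n)" using symp_J_alternating[of v v] by simp
  have "x \<bullet> (Y *v (?A *v x)) = 0" "y \<bullet> (Y *v (?A *v y)) = 0"
    unfolding YA by (rule J0)+
  then have "Re z * quad_form Y x - Im z * (x \<bullet> (Y *v y)) = 0"
    "Im z * (y \<bullet> (Y *v x)) + Re z * quad_form Y y = 0"
    unfolding xy(2,3) quad_form_def
    by (simp_all add: matrix_vector_right_distrib matrix_vector_mult_diff_distrib matrix_vector_mult_scaleR inner_simps)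
  then have "Re z * (quad_form Y x + quad_form Y y) = 0"
    using symmetric_form_commute[OF posdefD(1)[OF Y], of x y] by (simp add: algebra_simps)
  moreover have "0 < quad_form Y x + quad_form Y y"
    using xy(1) posdefD(2)[OF Y, of x] posdefD(2)[OF Y, of y] posdefD(3)[OF Y, of x] posdefD(3)[OF Y, of y] by fastforce
  ultimately show re: "Re z = 0" by simp
  show "Im z \<noteq> 0"
  proof
    assume "Im z = 0"
    then have "?A *v x = 0" "?A *v y = 0" using xy re by simp_all
    then have "symp_J *v x = 0" "symp_J *v y = 0" using YA[of x] YA[of y] by simp_all
    then show False using symp_J_injective xy(1) by blast
  qed
qed

text \<open>
  The entry at the last position is the largest one only because the list has length exactly \<open>n\<close>; this is where the
  count of the roots in the upper half plane, with multiplicity, is needed.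
\<close>

lemma imaginary_eigenvalue_le_d_eig:
  fixes Y :: "real^('n::finite + 'n)^('n + 'n)"
  assumes Y: "Y \<in> posdef_mats" and "0 < t"
    and root: "poly (charpoly (complex_mat (matrix_inv Y ** symp_J))) (\<i> * complex_of_real t) = 0"
  shows "t \<le> d_eig CARD('n) Y"
proof -
  let ?p = "charpoly (complex_mat (matrix_inv Y ** symp_J))"
  let ?L = "symp_eigenvalues Y"
  have p0: "?p \<noteq> 0" by (rule charpoly_nonzero)
  have mset: "mset ?L = image_mset Im (filter_mset (\<lambda>z. 0 < Im z) (proots ?p))"
    by (simp add: symp_eigenvalues_def filter_mset_image_mset)
  have "2 * size (filter_mset (\<lambda>z. 0 < Im z) (proots ?p)) = CARD('n + 'n)"
    by (rule size_upper_roots) (rule eigenvalue_purely_imaginary(2)[OF Y])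
  then have len: "length ?L = CARD('n)"
    using arg_cong[OF mset, of size] by simp
  have "t \<in># mset ?L"
    unfolding mset using root p0 \<open>0 < t\<close> by (force intro!: image_eqI[of _ _ "\<i> * complex_of_real t"])
  then obtain j where j: "j < length ?L" "?L ! j = t" by (auto simp: in_set_conv_nth)
  have "sorted ?L" by (simp add: symp_eigenvalues_def)
  then have "?L ! j \<le> ?L ! (CARD('n) - 1)"
    using j len by (intro sorted_nth_mono) auto
  then show ?thesis using j(2) by (simp add: d_eig_def)
qed

text \<open>
  The operator norm of \<open>B\<close> is attained at a unit vector \<open>x\<close>. There the positive semidefinite form
  \<open>\<mu>\<^sup>2 I + B\<^sup>2\<close> vanishes, so \<open>x\<close> lies in its kernel. This gives a real form of the eigenvector equation for \<open>\<i> \<mu>\<close>.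
\<close>

lemma skew_norm_attained:
  fixes B :: "real^'m^'m"
  assumes skew: "transpose B = - B"
  obtains x \<mu> where "norm x = 1" "norm (B *v x) = \<mu>" "B *v (B *v x) = - (\<mu>\<^sup>2 *\<^sub>R x)"
    "\<And>y. norm (B *v y) \<le> \<mu> * norm y"
proof -
  have "continuous_on (sphere 0 1) (\<lambda>x. norm (B *v x))"
    by (intro continuous_on_norm matrix_vector_mult_linear_continuous_on)
  then have "\<exists>x\<in>sphere 0 1. \<forall>y\<in>sphere 0 1. norm (B *v y) \<le> norm (B *v x)"
    by (intro continuous_attains_sup) simp_all
  then obtain x where x: "x \<in> sphere 0 1" "\<And>y. y \<in> sphere 0 1 \<Longrightarrow> norm (B *v y) \<le> norm (B *v x)"
    by blast
  define \<mu> where "\<mu> = norm (B *v x)"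
  have nx: "norm x = 1" using x(1) by simp
  have bound: "norm (B *v y) \<le> \<mu> * norm y" for y
  proof (cases "y = 0")
    case False
    have "norm (B *v ((1 / norm y) *\<^sub>R y)) \<le> \<mu>" unfolding \<mu>_def by (rule x(2)) (use False in simp)
    then show ?thesis using False by (simp add: matrix_vector_mult_scaleR field_simps)
  qed simp
  define S where "S = mat (\<mu>\<^sup>2) + B ** B"
  have S: "S *v y = \<mu>\<^sup>2 *\<^sub>R y + B *v (B *v y)" for y
    by (simp add: S_def matrix_vector_mult_add_rdistrib matrix_vector_mul_assoc)
       (simp add: matrix_vector_mult_def mat_def vec_eq_iff if_distrib if_distribR cong: if_cong)
  have symS: "transpose S = S"
  proof -
    have "transpose (B ** B) = (- B) ** (- B)" by (simp only: matrix_transpose_mul skew)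
    also have "\<dots> = B ** B" by (simp add: matrix_matrix_mult_def)
    finally have "transpose (B ** B) = B ** B" .
    moreover have "transpose S = mat (\<mu>\<^sup>2) + transpose (B ** B)"
      by (simp add: S_def transpose_def mat_def vec_eq_iff)
    ultimately show ?thesis by (simp add: S_def)
  qed
  have quadS: "quad_form S y = \<mu>\<^sup>2 * (norm y)\<^sup>2 - (norm (B *v y))\<^sup>2" for y
  proof -
    have "y \<bullet> (B *v (B *v y)) = - ((B *v y) \<bullet> (B *v y))"
      using inner_matrix_vector[of y B "B *v y"]
      by (simp add: skew uminus_matrix_vector_mult del: transpose_matrix_vector)
    then show ?thesis
      by (simp add: quad_form_def S inner_simps dot_square_norm)
  qed
  have "0 \<le> quad_form S y" for y
    using power_mono[OF bound[of y] norm_ge_zero, of 2] by (simp add: quadS power_mult_distrib)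
  moreover have "quad_form S x = 0" by (simp add: quadS nx \<mu>_def)
  ultimately have "S *v x = 0" using psd_kernel[OF symS] by blast
  then have "B *v (B *v x) = - (\<mu>\<^sup>2 *\<^sub>R x)" unfolding S by (simp add: eq_neg_iff_add_eq_0 add.commute)
  then show ?thesis using that nx bound \<mu>_def by blast
qed

text \<open>
  In a \<open>Y\<close>-orthonormal frame \<open>P\<close> the form \<open>J\<close> becomes the skew matrix \<open>B = P\<^sup>T J P\<close>, and \<open>Y\<^sup>-\<^sup>1 J\<close> becomes the
  linear map \<open>B\<close>. So the operator norm \<open>\<mu>\<close> of \<open>B\<close>, which bounds the form, gives the eigenvalue \<open>\<i> \<mu>\<close> of \<open>Y\<^sup>-\<^sup>1 J\<close>.
\<close>

lemma symp_form_bound: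
  fixes Y :: "real^('n::finite + 'n)^('n + 'n)"
  assumes Y: "Y \<in> posdef_mats"
  shows "\<bar>x \<bullet> (symp_J *v y)\<bar> \<le> d_eig CARD('n) Y * (sqrt (quad_form Y x) * sqrt (quad_form Y y))"
proof -
  obtain P :: "real^('n + 'n)^('n + 'n)" where P: "transpose P ** Y ** P = mat 1"
    using orthonormal_frame[OF Y] by blast
  have invP: "invertible P" using frame_invertible[OF P] .
  then obtain Pi where Pi: "P ** Pi = mat 1" "Pi ** P = mat 1" by (auto simp: invertible_def)
  define B where "B = transpose P ** symp_J ** P"
  have B: "u \<bullet> (B *v w) = (P *v u) \<bullet> (symp_J *v (P *v w))" for u w
    using inner_matrix_vector[of u "transpose P" "symp_J *v (P *v w)"]
    by (simp add: B_def matrix_vector_mul_assoc[symmetric] del: transpose_matrix_vector)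
  have "transpose B = - B"
    by (simp add: B_def matrix_transpose_mul transpose_symp_J matrix_mul_assoc)
       (simp add: matrix_matrix_mult_def vec_eq_iff sum_negf)
  then obtain e \<mu> where e: "norm e = 1" "norm (B *v e) = \<mu>" "B *v (B *v e) = - (\<mu>\<^sup>2 *\<^sub>R e)"
    "\<And>y. norm (B *v y) \<le> \<mu> * norm y"
    by (rule skew_norm_attained) blast
  have Yinv: "Y ** matrix_inv Y = mat 1" "matrix_inv Y ** Y = mat 1"
    using matrix_inv_inverse[OF posdef_invertible[OF Y]] by blast+
  have tP: "transpose Pi ** transpose P = mat 1" "transpose P ** transpose Pi = mat 1"
    using Pi by (metis matrix_transpose_mul transpose_mat)+
  have AP: "(matrix_inv Y ** symp_J) *v (P *v w) = P *v (B *v w)" for w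
  proof -
    have "Y ** (P ** B) = transpose Pi ** (transpose P ** Y ** P) ** B"
      by (simp only: matrix_mul_assoc tP matrix_mul_lid)
    also have "\<dots> = symp_J ** P"
      by (simp only: P matrix_mul_rid B_def matrix_mul_assoc tP matrix_mul_lid)
    finally have "matrix_inv Y ** (Y ** (P ** B)) = matrix_inv Y ** (symp_J ** P)" by simp
    then have "P ** B = matrix_inv Y ** symp_J ** P"
      by (simp only: matrix_mul_assoc Yinv matrix_mul_lid)
    then show ?thesis by (simp only: matrix_vector_mul_assoc)
  qed
  have kerP: "w = 0" if "P *v w = 0" for w
    using that Pi(2) by (metis matrix_left_invertible_ker)
  have "\<mu> \<noteq> 0"
  proof
    assume "\<mu> = 0"
    then have "P *v (B *v e) = 0" using e(2) by simp
    then have "(matrix_inv Y ** symp_J) *v (P *v e) = 0" using AP by simp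
    then have "Y *v ((matrix_inv Y ** symp_J) *v (P *v e)) = 0" by simp
    then have "symp_J *v (P *v e) = 0" by (simp add: matrix_vector_mul_assoc matrix_mul_assoc Yinv)
    then have "e = 0" using symp_J_injective kerP by blast
    then show False using e(1) by simp
  qed
  then have "0 < \<mu>" using e(2) norm_ge_zero[of "B *v e"] by simp
  \<comment> \<open>The eigenvector for \<open>\<i> \<mu>\<close> is the image of \<open>B e + \<i> \<mu> e\<close> under the frame.\<close>
  let ?x = "P *v (B *v e)" and ?y = "\<mu> *\<^sub>R (P *v e)"
  have "e \<noteq> 0" using e(1) by auto
  have "poly (charpoly (complex_mat (matrix_inv Y ** symp_J))) (\<i> * complex_of_real \<mu>) = 0"
    unfolding charpoly_root_iff
  proof (intro exI conjI)
    show "?x \<noteq> 0 \<or> ?y \<noteq> 0" using kerP[of e] \<open>\<mu> \<noteq> 0\<close> \<open>e \<noteq> 0\<close> by auto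
    show "(matrix_inv Y ** symp_J) *v ?x = Re (\<i> * complex_of_real \<mu>) *\<^sub>R ?x - Im (\<i> * complex_of_real \<mu>) *\<^sub>R ?y"
      unfolding AP e(3) by (simp add: matrix_vector_mult_uminus matrix_vector_mult_scaleR power2_eq_square)
    show "(matrix_inv Y ** symp_J) *v ?y = Im (\<i> * complex_of_real \<mu>) *\<^sub>R ?x + Re (\<i> * complex_of_real \<mu>) *\<^sub>R ?y"
      by (simp add: matrix_vector_mult_scaleR AP)
  qed
  then have "\<mu> \<le> d_eig CARD('n) Y"
    by (rule imaginary_eigenvalue_le_d_eig[OF Y \<open>0 < \<mu>\<close>])
  define u w where "u = Pi *v x" and "w = Pi *v y"
  have x: "x = P *v u" and y: "y = P *v w"
    by (simp_all add: u_def w_def matrix_vector_mul_assoc Pi)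
  have norm: "sqrt (quad_form Y x) = norm u" "sqrt (quad_form Y y) = norm w"
    unfolding x y frame_quad_form[OF P] by (simp_all add: norm_eq_sqrt_inner)
  have "\<bar>x \<bullet> (symp_J *v y)\<bar> = \<bar>u \<bullet> (B *v w)\<bar>" by (simp add: B x y)
  also have "\<dots> \<le> norm u * norm (B *v w)" by (rule Cauchy_Schwarz_ineq2)
  also have "\<dots> \<le> norm u * (\<mu> * norm w)" by (intro mult_left_mono e(4)) simp
  also have "\<dots> = \<mu> * (norm u * norm w)" by simp
  also have "\<dots> \<le> d_eig CARD('n) Y * (norm u * norm w)"
    using \<open>\<mu> \<le> _\<close> by (intro mult_right_mono) auto
  finally show ?thesis by (simp add: norm)
qed

section \<open>The arithmetic group and its orbits\<close>

lemma mat_act_mult: "mat_act (mat_act Y G) H = mat_act Y (G ** H)"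
  by (simp add: mat_act_def matrix_transpose_mul matrix_mul_assoc)

lemma mat_act_1: "mat_act Y (mat 1) = Y"
  by (simp add: mat_act_def)

lemma mat_act_entry:
  fixes Y :: "real^'m^'m"
  shows "mat_act Y G $ i $ j = (G *v axis i 1) \<bullet> (Y *v (G *v axis j 1))"
  unfolding matrix_entry_inner mat_act_def
  by (simp add: matrix_vector_mul_assoc[symmetric] inner_matrix_vector[of "axis i 1"] del: transpose_matrix_vector)

lemma delta_integral: "delta r = real_mat_of_int (\<chi> i j. if i = j then (case i of Inl k \<Rightarrow> int (r $ k) | Inr _ \<Rightarrow> 1) else 0)"
  by (auto simp: delta_def real_mat_of_int_def vec_eq_iff split: sum.split)

lemma delta_invertible:
  fixes r :: "nat^'n::finite"
  assumes "\<And>i. 0 < r $ i"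
  shows "invertible (delta r)"
proof -
  have "det (delta r) = (\<Prod>i\<in>UNIV. delta r $ i $ i)"
    by (rule det_diagonal) (simp add: delta_def)
  also have "\<dots> \<noteq> 0"
    using assms by (auto simp: delta_def split: sum.split)
  finally show ?thesis by (simp add: invertible_det_nz)
qed

lemma symp_J_integral: "symp_J = real_mat_of_int (\<chi> i j. case (i, j) of
       (Inl k, Inr l) \<Rightarrow> if k = l then 1 else 0
     | (Inr k, Inl l) \<Rightarrow> if k = l then - 1 else 0
     | _ \<Rightarrow> 0)"
  by (auto simp: symp_J_def real_mat_of_int_def vec_eq_iff split: sum.split)

lemma transpose_real_mat_of_int: "transpose (real_mat_of_int V) = real_mat_of_int (transpose V)"
  by (simp add: transpose_def real_mat_of_int_def)

lemma matrix_inv_mult_cancel: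
  fixes D :: "real^'m^'m"
  assumes "invertible D"
  shows "matrix_inv D ** (D ** A) = A" "D ** (matrix_inv D ** A) = A"
    "A ** D ** matrix_inv D = A" "A ** matrix_inv D ** D = A"
  using matrix_inv_inverse[OF assms] by (metis matrix_mul_assoc matrix_mul_lid matrix_mul_rid)+

lemma Pi_grpE:
  assumes "G \<in> Pi_grp r"
  obtains U \<epsilon> where "invertible U" "G = delta r ** real_mat_of_int U ** matrix_inv (delta r)"
    "invertible G" "\<epsilon> \<in> {1, -1}" "mat_act symp_J G = \<epsilon> *\<^sub>R symp_J"
  using assms unfolding Pi_grp_def G_grp_def ext_Sp_def mat_act_def by blast

lemma Pi_grpI:
  assumes "invertible U" "G = delta r ** real_mat_of_int U ** matrix_inv (delta r)"
    "invertible G" "\<epsilon> \<in> {1, -1}" "mat_act symp_J G = \<epsilon> *\<^sub>R symp_J"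
  shows "G \<in> Pi_grp r"
  using assms unfolding Pi_grp_def G_grp_def ext_Sp_def mat_act_def by blast

lemma mat_act_scaleR: "mat_act (c *\<^sub>R Y) G = c *\<^sub>R mat_act Y G" for Y :: "real^'m^'m"
  by (simp add: mat_act_def matrix_matrix_mult_def vec_eq_iff sum_distrib_left sum_distrib_right mult_ac)

lemma Pi_grp_1:
  assumes "invertible (delta r)"
  shows "mat 1 \<in> Pi_grp r"
proof (rule Pi_grpI[of "mat 1" _ _ 1])
  show "mat 1 = delta r ** real_mat_of_int (mat 1) ** matrix_inv (delta r)"
    using matrix_inv_inverse[OF assms] by (simp add: real_mat_of_int_1)
qed (auto simp: invertible_def mat_act_1 intro: exI[of _ "mat 1"])

lemma Pi_grp_mult:
  assumes inv: "invertible (delta r)" and "G \<in> Pi_grp r" "H \<in> Pi_grp r"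
  shows "G ** H \<in> Pi_grp r"
proof -
  let ?d = "delta r"
  obtain U a where G: "invertible U" "G = ?d ** real_mat_of_int U ** matrix_inv ?d"
    "invertible G" "a \<in> {1, -1}" "mat_act symp_J G = a *\<^sub>R symp_J" using assms(2) by (rule Pi_grpE)
  obtain W b where H: "invertible W" "H = ?d ** real_mat_of_int W ** matrix_inv ?d"
    "invertible H" "b \<in> {1, -1}" "mat_act symp_J H = b *\<^sub>R symp_J" using assms(3) by (rule Pi_grpE)
  show ?thesis
  proof (rule Pi_grpI[of "U ** W" _ _ "a * b"])
    show "invertible (U ** W)" using G(1) H(1) by (rule invertible_mult)
    show "G ** H = ?d ** real_mat_of_int (U ** W) ** matrix_inv ?d"
      unfolding G(2) H(2) real_mat_of_int_mult
      by (simp only: matrix_mul_assoc matrix_inv_mult_cancel[OF inv])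
    show "invertible (G ** H)" using G(3) H(3) by (rule invertible_mult)
    show "a * b \<in> {1, -1}" using G(4) H(4) by auto
    show "mat_act symp_J (G ** H) = (a * b) *\<^sub>R symp_J"
      unfolding mat_act_mult[symmetric] G(5) mat_act_scaleR H(5) by simp
  qed
qed

lemma Pi_grp_inverse:
  assumes inv: "invertible (delta r)" and "G \<in> Pi_grp r"
  obtains H where "H \<in> Pi_grp r" "G ** H = mat 1"
proof -
  let ?d = "delta r"
  obtain U a where G: "invertible U" "G = ?d ** real_mat_of_int U ** matrix_inv ?d"
    "invertible G" "a \<in> {1, -1}" "mat_act symp_J G = a *\<^sub>R symp_J" using assms(2) by (rule Pi_grpE)
  obtain W where W: "U ** W = mat 1" "W ** U = mat 1" using G(1) by (auto simp: invertible_def)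
  have WU: "real_mat_of_int U ** real_mat_of_int W = mat 1" "real_mat_of_int W ** real_mat_of_int U = mat 1"
    by (simp_all add: real_mat_of_int_mult[symmetric] W real_mat_of_int_1)
  define H where "H = ?d ** real_mat_of_int W ** matrix_inv ?d"
  have GH: "G ** H = mat 1"
  proof -
    have "G ** H = ?d ** (real_mat_of_int U ** real_mat_of_int W) ** matrix_inv ?d"
      unfolding G(2) H_def by (simp only: matrix_mul_assoc matrix_inv_mult_cancel[OF inv])
    then show ?thesis using matrix_inv_inverse[OF inv] by (simp add: WU)
  qed
  have "H \<in> Pi_grp r"
  proof (rule Pi_grpI[of W])
    show "invertible W" using W by (auto simp: invertible_def)
    show "invertible H" using GH by (metis invertible_left_inverse)
    have "symp_J = mat_act (mat_act symp_J G) H" by (simp only: mat_act_mult GH mat_act_1)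
    then have "symp_J = a *\<^sub>R mat_act symp_J H" by (simp only: G(5) mat_act_scaleR)
    then have "a *\<^sub>R symp_J = (a * a) *\<^sub>R mat_act symp_J H" by (metis scaleR_scaleR)
    also have "a * a = 1" using G(4) by auto
    finally show "mat_act symp_J H = a *\<^sub>R symp_J" by simp
  qed (use G(4) H_def in auto)
  then show ?thesis using GH that by blast
qed

lemma orbit_mat_act:
  assumes inv: "invertible (delta r)" and G: "G \<in> Pi_grp r"
  shows "orbit r (mat_act Y G) = orbit r Y"
proof
  show "orbit r (mat_act Y G) \<subseteq> orbit r Y"
    unfolding orbit_def using Pi_grp_mult[OF inv G] by (auto simp: mat_act_mult)
  obtain H where H: "H \<in> Pi_grp r" "G ** H = mat 1" using Pi_grp_inverse[OF inv G] .
  have "mat_act Y F = mat_act (mat_act Y G) (H ** F)" for F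
    by (simp only: mat_act_mult matrix_mul_assoc H(2) matrix_mul_lid)
  then show "orbit r Y \<subseteq> orbit r (mat_act Y G)"
    unfolding orbit_def using Pi_grp_mult[OF inv H(1)] by blast
qed

lemma orbit_eq_iff:
  assumes inv: "invertible (delta r)"
  shows "orbit r Y = orbit r Z \<longleftrightarrow> (\<exists>G\<in>Pi_grp r. Y = mat_act Z G)"
proof
  assume "orbit r Y = orbit r Z"
  moreover have "Y \<in> orbit r Y"
    unfolding orbit_def using Pi_grp_1[OF inv] by (metis image_eqI mat_act_1)
  ultimately show "\<exists>G\<in>Pi_grp r. Y = mat_act Z G" by (auto simp: orbit_def)
qed (use orbit_mat_act[OF inv] in auto)

section \<open>Closed images of compact sets in the orbit space\<close>

lemma abs_le_ceilingD: "\<bar>real_of_int k\<bar> \<le> t \<Longrightarrow> k \<in> {- \<lceil>t\<rceil>..\<lceil>t\<rceil>}"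
  by (auto simp: abs_le_iff le_ceiling_iff) linarith+

text \<open>
  Conjugation by \<open>\<delta>\<^sub>r\<close> turns a bounded set of such matrices into a bounded set of integer matrices.
\<close>

lemma finite_bounded_Pi_grp:
  fixes r :: "nat^'n::finite"
  assumes inv: "invertible (delta r)"
  shows "finite {G \<in> Pi_grp r. \<forall>i j. \<bar>G $ i $ j\<bar> \<le> t}"
proof -
  let ?d = "delta r"
  let ?C = "{G :: real^('n + 'n)^('n + 'n). \<forall>i j. \<bar>G $ i $ j\<bar> \<le> t}"
  have "closed ?C"
    by (intro closed_Collect_all closed_Collect_le continuous_intros)
  moreover have "bounded ?C" unfolding bounded_iff using matrix_norm_le by blast
  ultimately have "compact ?C" by (simp only: compact_eq_bounded_closed)
  moreover have "continuous_on ?C (\<lambda>G. matrix_inv ?d ** G ** ?d)"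
    by (intro continuous_on_matrix_mult continuous_on_const continuous_on_id)
  ultimately have "compact ((\<lambda>G. matrix_inv ?d ** G ** ?d) ` ?C)"
    by (rule compact_continuous_image[rotated])
  then obtain R where "\<forall>X\<in>(\<lambda>G. matrix_inv ?d ** G ** ?d) ` ?C. norm X \<le> R"
    by (meson compact_imp_bounded bounded_iff)
  then have R: "norm (matrix_inv ?d ** G ** ?d) \<le> R" if "G \<in> ?C" for G
    using that by blast
  define F where "F = {U :: int^('n + 'n)^('n + 'n). \<forall>i. U $ i \<in> {a. \<forall>j. a $ j \<in> {- \<lceil>R\<rceil>..\<lceil>R\<rceil>}}}"
  have "finite F" unfolding F_def by (intro finite_vecs_componentwise) simp
  moreover have "{G \<in> Pi_grp r. \<forall>i j. \<bar>G $ i $ j\<bar> \<le> t} \<subseteq> (\<lambda>U. ?d ** real_mat_of_int U ** matrix_inv ?d) ` F"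
  proof
    fix G assume G: "G \<in> {G \<in> Pi_grp r. \<forall>i j. \<bar>G $ i $ j\<bar> \<le> t}"
    then obtain U where U: "G = ?d ** real_mat_of_int U ** matrix_inv ?d" using Pi_grpE by blast
    then have "matrix_inv ?d ** G ** ?d = real_mat_of_int U"
      by (simp only: matrix_mul_assoc[symmetric] matrix_inv_mult_cancel[OF inv])
         (use matrix_inv_inverse[OF inv] in simp)
    then have "norm (real_mat_of_int U) \<le> R" using R[of G] G by simp
    then have "\<bar>real_mat_of_int U $ i $ j\<bar> \<le> R" for i j
      using component_le_norm_cart[of "real_mat_of_int U $ i" j] Finite_Cartesian_Product.norm_nth_le[of "real_mat_of_int U" i]
      by linarith
    then have "\<bar>real_of_int (U $ i $ j)\<bar> \<le> R" for i j by (simp add: real_mat_of_int_def)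
    then have "U $ i $ j \<in> {- \<lceil>R\<rceil>..\<lceil>R\<rceil>}" for i j
      by (rule abs_le_ceilingD)
    then have "U \<in> F" unfolding F_def by blast
    then show "G \<in> (\<lambda>U. ?d ** real_mat_of_int U ** matrix_inv ?d) ` F" using U by (rule image_eqI[rotated])
  qed
  ultimately show ?thesis using finite_subset finite_imageI by meson
qed

lemma compact_posdef_coercive:
  fixes K :: "(real^'m^'m) set"
  assumes "compact K" "K \<subseteq> posdef_mats"
  obtains a where "0 < a" "\<And>Z x. Z \<in> K \<Longrightarrow> a * (norm x)\<^sup>2 \<le> quad_form Z x"
proof (cases "K = {}")
  case False
  let ?S = "K \<times> sphere (0::real^'m) 1"
  let ?q = "\<lambda>p. quad_form (fst p) (snd p)"
  have "continuous_on ?S ?q"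
    unfolding quad_form_def matrix_vector_mult_def inner_vec_def by (intro continuous_intros)
  moreover have "compact ?S" using assms(1) by (intro compact_Times) auto
  moreover have "?S \<noteq> {}" using False by simp
  ultimately obtain p where p: "p \<in> ?S" "\<And>q. q \<in> ?S \<Longrightarrow> ?q p \<le> ?q q"
    using continuous_attains_inf[of ?S ?q] by blast
  have "snd p \<noteq> 0" using p(1) by auto
  then have "0 < ?q p" using p(1) assms(2) posdefD(2)[of "fst p" "snd p"] by auto
  moreover have "?q p * (norm x)\<^sup>2 \<le> quad_form Z x" if "Z \<in> K" for Z x
  proof (cases "x = 0")
    case True
    then show ?thesis by (simp add: quad_form_def)
  next
    case False
    have "?q p \<le> quad_form Z ((1 / norm x) *\<^sub>R x)"
      using p(2)[of "(Z, (1 / norm x) *\<^sub>R x)"] False that by simp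
    then show ?thesis
      unfolding quad_form_scaleR using False by (simp add: field_simps power_divide)
  qed
  ultimately show ?thesis by (rule that)
qed (use that[of 1] in auto)

text \<open>
  It has to be shown that the saturation \<open>T\<close> of \<open>K\<close> is closed. On the open set \<open>N t\<close> of matrices with diagonal
  entries less than \<open>t\<close>, only the finitely many group elements in \<open>F t\<close> matter, because \<open>a |G e\<^sub>j|\<^sup>2 \<le> Z[G e\<^sub>j] = Y\<^sub>j\<^sub>j < t\<close>.
  So \<open>T\<close> agrees there with the compact set \<open>C t\<close>.
\<close>

lemma closedin_orbit_image:
  fixes r :: "nat^'n::finite"
  assumes inv: "invertible (delta r)" and K: "compact K" "K \<subseteq> posdef_mats"
  shows "closedin (orbit_space r) (orbit r ` K)"
proof -
  let ?P = "posdef_mats :: (real^('n + 'n)^('n + 'n)) set"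
  obtain a where a: "0 < a" "\<And>Z x. Z \<in> K \<Longrightarrow> a * (norm x)\<^sup>2 \<le> quad_form Z x"
    using compact_posdef_coercive[OF K] by blast
  define T where "T = {Y \<in> ?P. orbit r Y \<in> orbit r ` K}"
  have T: "Y \<in> T \<longleftrightarrow> Y \<in> ?P \<and> (\<exists>Z\<in>K. \<exists>G\<in>Pi_grp r. Y = mat_act Z G)" for Y
    unfolding T_def image_iff using orbit_eq_iff[OF inv] by auto
  define F where "F t = {G \<in> Pi_grp r. \<forall>i j. \<bar>G $ i $ j\<bar> \<le> sqrt (t / a)}" for t
  define C where "C t = (\<Union>G\<in>F t. (\<lambda>Z. mat_act Z G) ` K)" for t
  define N where "N t = {Y :: real^('n + 'n)^('n + 'n). \<forall>i. Y $ i $ i < t}" for t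
  have "compact (C t)" for t
    unfolding C_def F_def
    by (intro compact_UN finite_bounded_Pi_grp[OF inv] compact_continuous_image continuous_on_mat_act K(1))
  then have openC: "open (- C t)" for t by (simp add: compact_imp_closed open_Compl)
  have openN: "open (N t)" for t
  proof -
    have "N t = (\<Inter>i. {Y. Y $ i $ i < t})" by (auto simp: N_def)
    moreover have "open {Y :: real^('n + 'n)^('n + 'n). Y $ i $ i < t}" for i
      by (intro open_Collect_less continuous_intros)
    ultimately show ?thesis by (simp only:) (intro open_INT, auto)
  qed
  have bounded: "Y \<in> C t" if Y: "Y \<in> T" "Y \<in> N t" for Y t
  proof -
    obtain Z G where Z: "Z \<in> K" "G \<in> Pi_grp r" "Y = mat_act Z G" using Y(1) T by blast
    have "\<bar>G $ i $ j\<bar> \<le> sqrt (t / a)" for i j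
    proof -
      have "G $ i $ j = (G *v axis j 1) $ i" by (simp add: matrix_vector_mult_basis column_def)
      then have "\<bar>G $ i $ j\<bar>\<^sup>2 \<le> (norm (G *v axis j 1))\<^sup>2"
        using component_le_norm_cart[of "G *v axis j 1" i] by (intro power_mono) auto
      also have "a * (norm (G *v axis j 1))\<^sup>2 \<le> t"
      proof -
        have "a * (norm (G *v axis j 1))\<^sup>2 \<le> quad_form Z (G *v axis j 1)" using a(2)[OF Z(1)] .
        also have "\<dots> = Y $ j $ j"
          unfolding quad_form_mat_act[symmetric] Z(3)[symmetric] by (simp add: quad_form_def matrix_entry_inner[of Y])
        also have "\<dots> \<le> t" using Y(2) by (simp add: N_def less_imp_le)
        finally show ?thesis .
      qed
      then have "(norm (G *v axis j 1))\<^sup>2 \<le> t / a" using a(1) by (simp add: field_simps)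
      finally show ?thesis by (simp add: real_le_rsqrt)
    qed
    then show ?thesis using Z by (auto simp: C_def F_def)
  qed
  have "?P - T = ?P \<inter> (\<Union>n::nat. N (real n) \<inter> - C (real n))"
  proof (intro equalityI subsetI)
    fix Y assume Y: "Y \<in> ?P - T"
    obtain n :: nat where n: "Max (range (\<lambda>i. Y $ i $ i)) < real n" using reals_Archimedean2 by blast
    have "Y $ i $ i < real n" for i
      by (rule le_less_trans[OF Max_ge n]) auto
    moreover have "Y \<notin> C (real n)" using Y T by (auto simp: C_def F_def)
    ultimately show "Y \<in> ?P \<inter> (\<Union>n::nat. N (real n) \<inter> - C (real n))"
      using Y by (auto simp: N_def)
  next
    fix Y assume "Y \<in> ?P \<inter> (\<Union>n::nat. N (real n) \<inter> - C (real n))"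
    then show "Y \<in> ?P - T" using bounded by blast
  qed
  then have "openin (top_of_set ?P) (?P - T)"
    unfolding openin_open using openC openN by (metis (no_types, lifting) open_Int open_UN)
  then have cl: "closedin (top_of_set ?P) T"
    by (simp add: closedin_def T_def)
  have "quotient_map (top_of_set ?P) (orbit_space r) (orbit r)"
    unfolding orbit_space_def by (rule quotient_map_quotient_topology)
  moreover have "orbit r ` K \<subseteq> topspace (orbit_space r)"
    using K(2) by (auto simp: orbit_space_def topspace_quotient_topology)
  ultimately show ?thesis
    using cl unfolding quotient_map_closedin T_def by auto
qed

section \<open>Reduction into a compact set\<close>

text \<open>
  The reduction described at the beginning. Here \<open>Q\<close> is the compact set containing \<open>Z = Y[\<delta>\<^sub>r V]\<close>, \<open>\<V>\<close> is the
  set of all integer matrices \<open>V\<close> that can occur, and \<open>F\<close> contains one representative for each value of \<open>key\<close>.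
\<close>

lemma posdef_reduction:
  fixes r :: "nat^'n::finite"
  assumes inv: "invertible (delta r)" and pos: "0 < C\<^sub>0" "0 < C\<^sub>2"
  obtains K where "compact K" "K \<subseteq> posdef_mats"
    "\<And>Y. Y \<in> posdef_mats \<Longrightarrow> C\<^sub>0 \<le> m_min r Y \<Longrightarrow> det Y \<le> C\<^sub>1 \<Longrightarrow> d_eig CARD('n) Y \<le> C\<^sub>2 \<Longrightarrow>
      \<exists>G\<in>Pi_grp r. mat_act Y G \<in> K"
proof -
  let ?d = "delta r" and ?R = "real_mat_of_int :: int^('n + 'n)^('n + 'n) \<Rightarrow> _"
  define \<omega> where "\<omega> = measure lebesgue (ball (0::real^('n + 'n)) (sqrt C\<^sub>0 / 2))"
  have "0 < \<omega>" using content_ball_pos[of "sqrt C\<^sub>0 / 2" "0::real^('n + 'n)"] pos(1) by (simp add: \<omega>_def)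
  \<comment> \<open>\<open>\<omega>\<close> is the volume of the packing balls; together \<open>N\<close> of them have a volume larger than every possible \<open>sqrt (det Y')\<close>.\<close>
  then obtain N where N: "sqrt ((det ?d)\<^sup>2 * C\<^sub>1) < real N * \<omega>" using ex_less_of_nat_mult by blast
  define b where "b = 2 * C\<^sub>0 * (1 + (real N)\<^sup>2)"
  have "0 \<le> b" using pos(1) by (simp add: b_def)
  define Q where "Q = (bounded_forms b (\<omega>\<^sup>2) :: (real^('n + 'n)^('n + 'n)) set)"
  have Q: "compact Q" "Q \<subseteq> posdef_mats"
    unfolding Q_def using \<open>0 < \<omega>\<close> by (auto intro!: compact_bounded_forms bounded_forms_posdef)
  have "compact (det ` Q)" using Q(1) by (intro compact_continuous_image continuous_on_det_matrix)
  then obtain D where "\<forall>x\<in>det ` Q. norm x \<le> D"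
    by (meson compact_imp_bounded bounded_iff)
  then have D: "\<bar>det Z\<bar> \<le> D" if "Z \<in> Q" for Z using that by simp
  define key where "key V = (lattice_key V, mat_act symp_J (?d ** ?R V))" for V
  define \<V> where "\<V> = {V :: int^('n + 'n)^('n + 'n). det V \<noteq> 0 \<and> \<bar>det V\<bar> \<le> \<lceil>D / \<omega>\<^sup>2\<rceil> \<and>
    (\<forall>i j. \<bar>mat_act symp_J (?d ** ?R V) $ i $ j\<bar> \<le> C\<^sub>2 * b)}"
  \<comment> \<open>Both components take finitely many values: the index is bounded, and \<open>J[\<delta>\<^sub>r V]\<close> is a bounded integer matrix.\<close>
  have "finite (key ` \<V>)"
  proof (rule finite_subset)
    let ?B = "{a :: int^('n + 'n). \<forall>j. a $ j \<in> {- \<lceil>C\<^sub>2 * b\<rceil>..\<lceil>C\<^sub>2 * b\<rceil>}}"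
    let ?W = "?R ` {W. \<forall>i. W $ i \<in> ?B}"
    show "finite (lattice_key ` {V :: int^('n + 'n)^('n + 'n). \<bar>det V\<bar> \<le> \<lceil>D / \<omega>\<^sup>2\<rceil>} \<times> ?W)"
      by (intro finite_cartesian_product finite_lattice_keys finite_imageI finite_vecs_componentwise) simp
    have "mat_act symp_J (?d ** ?R V) \<in> ?W" if V: "V \<in> \<V>" for V
    proof -
      obtain \<Delta> J :: "int^('n + 'n)^('n + 'n)" where "?d = ?R \<Delta>" "symp_J = ?R J"
        using delta_integral symp_J_integral by blast
      then have "mat_act symp_J (?d ** ?R V) = ?R (transpose (\<Delta> ** V) ** J ** (\<Delta> ** V))"
        by (simp only: mat_act_def real_mat_of_int_mult transpose_real_mat_of_int[symmetric])
      then obtain W where W: "mat_act symp_J (?d ** ?R V) = ?R W" by blast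
      have "\<bar>real_of_int (W $ i $ j)\<bar> \<le> C\<^sub>2 * b" for i j
        using V W by (simp add: \<V>_def real_mat_of_int_def)
      then have "W $ i $ j \<in> {- \<lceil>C\<^sub>2 * b\<rceil>..\<lceil>C\<^sub>2 * b\<rceil>}" for i j
        by (rule abs_le_ceilingD)
      then show ?thesis using W by blast
    qed
    then show "key ` \<V> \<subseteq> lattice_key ` {V :: int^('n + 'n)^('n + 'n). \<bar>det V\<bar> \<le> \<lceil>D / \<omega>\<^sup>2\<rceil>} \<times> ?W"
      by (auto simp: key_def \<V>_def)
  qed
  then obtain F where F: "F \<subseteq> \<V>" "finite F" "key ` \<V> = key ` F"
    by (metis finite_subset_image subset_refl)
  have invd: "invertible (?d ** ?R V)" if "V \<in> \<V>" for V
    using that by (intro invertible_mult inv) (simp add: \<V>_def invertible_det_nz det_real_mat_of_int)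
  define K where "K = (\<Union>W\<in>F. (\<lambda>Z. mat_act Z (matrix_inv (?d ** ?R W))) ` Q)"
  show ?thesis
  proof (rule that[of K])
    show "compact K" unfolding K_def
      by (intro compact_UN F(2) compact_continuous_image continuous_on_mat_act Q(1))
    show "K \<subseteq> posdef_mats"
    proof -
      have "invertible (matrix_inv (?d ** ?R W))" if "W \<in> F" for W
        using matrix_inv_inverse[OF invd] that F(1) invertible_def by blast
      then show ?thesis unfolding K_def using Q(2) by (auto intro!: mat_act_posdef)
    qed
    fix Y :: "real^('n + 'n)^('n + 'n)"
    assume Y: "Y \<in> posdef_mats" and m: "C\<^sub>0 \<le> m_min r Y" and det: "det Y \<le> C\<^sub>1"
      and eig: "d_eig CARD('n) Y \<le> C\<^sub>2"
    define Y' where "Y' = mat_act Y ?d"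
    have Y': "Y' \<in> posdef_mats" unfolding Y'_def by (rule mat_act_posdef[OF Y inv])
    have min: "C\<^sub>0 \<le> quad_form Y' (real_vec_of_int a)" if "a \<noteq> 0" for a
    proof -
      have "m_min r Y \<le> quad_form Y (?d *v real_vec_of_int a)"
        unfolding m_min_def
        by (rule cInf_lower) (use that posdefD(3)[OF Y] in \<open>auto intro!: bdd_belowI[of _ 0]\<close>)
      then show ?thesis using m by (simp add: Y'_def quad_form_mat_act)
    qed
    have detY': "\<omega>\<^sup>2 \<le> det Y'"
      unfolding \<omega>_def by (rule det_lower_bound_of_minimum[OF Y' pos(1) min])
    have "det Y' = (det ?d)\<^sup>2 * det Y"
      by (simp add: Y'_def mat_act_def det_mul power2_eq_square)
    also have "\<dots> \<le> (det ?d)\<^sup>2 * C\<^sub>1" using det by (intro mult_left_mono) auto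
    finally have "sqrt (det Y') < real N * \<omega>" using N by (meson le_less_trans real_sqrt_le_mono)
    then have "span {real_vec_of_int a | a. quad_form Y' (real_vec_of_int a) \<le> b} = UNIV"
      unfolding b_def \<omega>_def by (rule short_vectors_span[OF Y' pos(1) min, rotated])
    then have "span (real_vec_of_int ` {a. quad_form Y' (real_vec_of_int a) \<le> b}) = UNIV"
      by (simp add: setcompr_eq_image)
    then obtain V where V: "invertible (?R V)" "\<And>j. quad_form Y' (real_vec_of_int (column j V)) \<le> b"
      by (rule integer_frame) blast
    have detV: "det V \<noteq> 0" using V(1) by (simp add: invertible_det_nz det_real_mat_of_int)
    define Z where "Z = mat_act Y' (?R V)"
    have Z: "Z = mat_act Y (?d ** ?R V)" by (simp add: Z_def Y'_def mat_act_mult)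
    have Zpos: "Z \<in> posdef_mats" unfolding Z_def by (rule mat_act_posdef[OF Y' V(1)])
    have col: "?R V *v axis j 1 = real_vec_of_int (column j V)" for j
      by (simp add: matrix_vector_mult_basis column_def real_mat_of_int_def real_vec_of_int_def)
    have diag: "quad_form Z (axis j 1) \<le> b" for j
      unfolding Z_def quad_form_mat_act col by (rule V(2))
    have detZ: "det Z = (real_of_int (det V))\<^sup>2 * det Y'"
      by (simp add: Z_def mat_act_def det_mul det_real_mat_of_int power2_eq_square)
    have detV1: "1 \<le> \<bar>real_of_int (det V)\<bar>" using detV by linarith
    then have detV2: "\<bar>real_of_int (det V)\<bar> \<le> (real_of_int (det V))\<^sup>2"
      by (metis power2_abs power2_eq_square mult_left_mono mult_1_right abs_ge_zero)
    have "1 * \<omega>\<^sup>2 \<le> det Z" unfolding detZ using detV1 detV2 detY' by (intro mult_mono) auto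
    then have "Z \<in> Q"
      unfolding Q_def bounded_forms_def
      using posdefD(1,3)[OF Zpos] psd_entry_bound[OF posdefD(1,3)[OF Zpos] diag] by simp
    have "V \<in> \<V>"
      unfolding \<V>_def
    proof (intro CollectI conjI allI detV)
      have "\<bar>real_of_int (det V)\<bar> * \<omega>\<^sup>2 \<le> det Z"
        unfolding detZ using detV2 detY' by (intro mult_mono) auto
      also have "\<dots> \<le> D" using D[OF \<open>Z \<in> Q\<close>] by simp
      finally have "\<bar>real_of_int (det V)\<bar> \<le> D / \<omega>\<^sup>2" using \<open>0 < \<omega>\<close> by (simp add: field_simps)
      then show "\<bar>det V\<bar> \<le> \<lceil>D / \<omega>\<^sup>2\<rceil>" by (simp add: le_ceiling_iff)
    next
      fix i j
      let ?v = "\<lambda>k. (?d ** ?R V) *v axis k 1"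
      have len: "quad_form Y (?v k) \<le> b" for k
        using diag[of k] by (simp add: Z quad_form_mat_act)
      have "\<bar>mat_act symp_J (?d ** ?R V) $ i $ j\<bar> \<le> d_eig CARD('n) Y * (sqrt (quad_form Y (?v i)) * sqrt (quad_form Y (?v j)))"
        unfolding mat_act_entry by (rule symp_form_bound[OF Y])
      also have "\<dots> \<le> C\<^sub>2 * (sqrt (quad_form Y (?v i)) * sqrt (quad_form Y (?v j)))"
        using eig posdefD(3)[OF Y] by (intro mult_right_mono) auto
      also have "\<dots> \<le> C\<^sub>2 * (sqrt b * sqrt b)"
        using pos(2) len posdefD(3)[OF Y] \<open>0 \<le> b\<close> by (intro mult_left_mono mult_mono real_sqrt_le_mono) auto
      also have "sqrt b * sqrt b = b" using \<open>0 \<le> b\<close> by simp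
      finally show "\<bar>mat_act symp_J (?d ** ?R V) $ i $ j\<bar> \<le> C\<^sub>2 * b" .
    qed
    then obtain W where W: "W \<in> F" "key V = key W" using F(3) by blast
    then have "W \<in> \<V>" using F(1) by blast
    then have detW: "det W \<noteq> 0" by (simp add: \<V>_def)
    obtain U where U: "invertible U" "?R V = ?R U ** ?R W"
      using lattice_key_unimodular[OF _ detV detW] W(2) by (auto simp: key_def)
    \<comment> \<open>Equal keys make \<open>U\<close> unimodular and let \<open>G = (\<delta>\<^sub>r V)(\<delta>\<^sub>r W)\<^sup>-\<^sup>1\<close> preserve \<open>J\<close>.\<close>
    define G where "G = ?d ** ?R U ** matrix_inv ?d"
    let ?I = "matrix_inv (?d ** ?R W)"
    note invW = matrix_inv_inverse[OF invd[OF \<open>W \<in> \<V>\<close>]]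
    have "invertible ?I" unfolding invertible_def using invW by (intro exI[of _ "?d ** ?R W"]) simp
    have "G ** (?d ** ?R W) = ?d ** ?R V"
      unfolding G_def U(2) by (simp only: matrix_mul_assoc matrix_inv_mult_cancel[OF inv])
    then have G: "G = ?d ** ?R V ** ?I"
      using invW by (metis matrix_mul_assoc matrix_mul_rid)
    have "mat_act Y G = mat_act Z ?I" unfolding G Z by (rule mat_act_mult[symmetric])
    then have "mat_act Y G \<in> K" using W(1) \<open>Z \<in> Q\<close> by (auto simp: K_def)
    moreover have "G \<in> Pi_grp r"
    proof (rule Pi_grpI[OF U(1) G_def, of 1])
      show "invertible G"
        unfolding G using invd[OF \<open>V \<in> \<V>\<close>] \<open>invertible ?I\<close> by (rule invertible_mult)
      have "mat_act symp_J G = mat_act (mat_act symp_J (?d ** ?R W)) ?I"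
        using W(2) by (simp only: G mat_act_mult[symmetric] key_def prod.inject)
      also have "\<dots> = symp_J" using invW by (simp only: mat_act_mult mat_act_1)
      finally show "mat_act symp_J G = 1 *\<^sub>R symp_J" by simp
    qed simp
    ultimately show "\<exists>G\<in>Pi_grp r. mat_act Y G \<in> K" by blast
  qed
qed

section \<open>Compactness of the closure\<close>

theorem theorem3p13:
  fixes r :: "nat^'n::{finite,linorder}"
    and M :: "(real^('n + 'n)^('n + 'n)) set set"
    and C\<^sub>0 C\<^sub>1 C\<^sub>2 :: real
  assumes "r \<in> div_chains"
    and "M \<subseteq> topspace (orbit_space r)"
    and "0 < C\<^sub>0" and "0 < C\<^sub>1" and "0 < C\<^sub>2"
    and "\<And>Y. Y \<in> posdef_mats \<Longrightarrow> orbit r Y \<in> M \<Longrightarrow>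
           C\<^sub>0 \<le> m_min r Y \<and> det Y \<le> C\<^sub>1 \<and> d_eig CARD('n) Y \<le> C\<^sub>2"
  shows "compactin (orbit_space r) (orbit_space r closure_of M)"
proof -
  have inv: "invertible (delta r)"
    using assms(1) by (intro delta_invertible) (simp add: div_chains_def)
  obtain K where K: "compact K" "K \<subseteq> posdef_mats"
    and red: "\<And>Y. Y \<in> posdef_mats \<Longrightarrow> C\<^sub>0 \<le> m_min r Y \<Longrightarrow> det Y \<le> C\<^sub>1 \<Longrightarrow> d_eig CARD('n) Y \<le> C\<^sub>2 \<Longrightarrow>
      \<exists>G\<in>Pi_grp r. mat_act Y G \<in> K"
    using posdef_reduction[OF inv assms(3,5)] by blast
  have "M \<subseteq> orbit r ` K"
  proof
    fix m assume "m \<in> M"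
    then obtain Y where Y: "Y \<in> posdef_mats" "m = orbit r Y"
      using assms(2) by (auto simp: orbit_space_def topspace_quotient_topology)
    then obtain G where "G \<in> Pi_grp r" "mat_act Y G \<in> K"
      using red assms(6) \<open>m \<in> M\<close> by blast
    then show "m \<in> orbit r ` K" using orbit_mat_act[OF inv] Y(2) by blast
  qed
  then have "orbit_space r closure_of M \<subseteq> orbit r ` K"
    by (rule closure_of_minimal) (rule closedin_orbit_image[OF inv K])
  moreover have "compactin (orbit_space r) (orbit r ` K)"
  proof (rule image_compactin)
    show "compactin (top_of_set posdef_mats) K"
      using K by (simp add: compactin_subtopology)
    show "continuous_map (top_of_set posdef_mats) (orbit_space r) (orbit r)"
      unfolding orbit_space_def
      by (rule quotient_imp_continuous_map[OF quotient_map_quotient_topology])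
  qed
  ultimately show ?thesis
    by (meson closed_compactin closedin_closure_of)
qed

end
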